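(* Let $n\ge1$ and $\kappa\ge1$. Every bi-invariant polynomial ${\sf BP}={\sf BP}(j^\kappa f)\in UE_{\kappa,m}^n$ of weight $m$ (invariant by reparametrization and under the unipotent action) can be written in the form $${\sf BP}(j^\kappa f)=\sum_{-\frac{\kappa-1}{\kappa}m\le a\le m}(f_1')^a\,{\sf BP}_a\left(\begin{vmatrix} \Lambda_{1,2}^{2\lambda_2-1}&\Lambda_{1,3}^{2\lambda_2-1}&\cdots&\Lambda_{1,n_1}^{2\lambda_2-1}\\ \Lambda_{1,2}^{2\lambda_3-1}&\Lambda_{1,3}^{2\lambda_3-1}&\cdots&\Lambda_{1,n_1}^{2\lambda_3-1}\\ \vdots&\vdots&\ddots&\vdots\\ \Lambda_{1,2}^{2\lambda_{n_1}-1}&\Lambda_{1,3}^{2\lambda_{n_1}-1}&\cdots&\Lambda_{1,n_1}^{2\lambda_{n_1}-1} \end{vmatrix}\ :\ 2\le n_1\le n,\ 2\le\lambda_2,\dots,\lambda_{n_1}\le\kappa\right),$$ where $a$ runs over integers and the ${\sf BP}_a$ are certain polynomials (depending on ${\sf BP}$) in all the displayed determinants.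
   Context: $\mathbb{C}[j^\kappa f]$ is the polynomial ring in the variables $f_i^{(\lambda)}$, $1\le i\le n$, $1\le\lambda\le\kappa$ (jet coordinates of germs $f:(\mathbb{C},0)\to\mathbb{C}^n$). ${\sf P}\in\mathbb{C}[j^\kappa f]$ is invariant by reparametrization of weight $m$ if ${\sf P}(j^\kappa(f\circ\phi))=(\phi')^m{\sf P}((j^\kappa f)\circ\phi)$ for all local biholomorphisms $\phi$ of $(\mathbb{C},0)$. A bi-invariant is such a polynomial satisfying moreover ${\sf P}({\sf u}\cdot j^\kappa f)={\sf P}(j^\kappa f)$ for every lower triangular unipotent ${\sf u}=(u_{ij})\in GL_n(\mathbb{C})$ acting at each jet level by $f_i^{(\lambda)}\mapsto f_i^{(\lambda)}+\sum_{j<i}u_{ij}f_j^{(\lambda)}$; $UE_{\kappa,m}^n$ is the space of bi-invariants of weight $m$. Bracket of invariants of weights $p,q$: $[{\sf P},{\sf Q}]=q\,{\sf D}{\sf P}\cdot{\sf Q}-p\,{\sf P}\cdot{\sf D}{\sf Q}$, where ${\sf D}=\sum_{k,\lambda}f_k^{(\lambda+1)}\partial/\partial f_k^{(\lambda)}$. For $2\le i\le n$ and $2\le\lambda\le\kappa$, $\Lambda_{1,i}^{2\lambda-1}$ abbreviates the invariant $\Lambda_{1,i;1^{\lambda-2}}^{2\lambda-1}$ of weight $2\lambda-1$ defined by $\Lambda_{1,i}^3=[f_i',f_1']$ and $\Lambda_{1,i}^{2\lambda-1}=[\Lambda_{1,i}^{2\lambda-3},f_1']$ for $\lambda\ge3$.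 *)

theory Defs
  imports
    "HOL-Complex_Analysis.Complex_Analysis"
    "HOL-Library.Poly_Mapping"
    "Jordan_Normal_Form.Determinant"
begin

text \<open>A polynomial is a finitely supported map from monomials to coefficients, a monomial is a
  finitely supported map from variables to exponents. The ring structure is the one
  \<^theory>\<open>HOL-Library.Poly_Mapping\<close> provides (convolution product).\<close>

type_synonym 'v cpoly = "('v \<Rightarrow>\<^sub>0 nat) \<Rightarrow>\<^sub>0 complex"

definition Const :: "complex \<Rightarrow> 'v cpoly" where
  "Const c = Poly_Mapping.single 0 c"

definition Var :: "'v \<Rightarrow> 'v cpoly" where
  "Var v = Poly_Mapping.single (Poly_Mapping.single v 1) 1"

definition vars :: "'v cpoly \<Rightarrow> 'v set" where
  "vars P = (\<Union>m\<in>Poly_Mapping.keys P. Poly_Mapping.keys m)"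

definition poly_value :: "(complex \<Rightarrow> 'a::comm_ring_1) \<Rightarrow> ('v \<Rightarrow> 'a) \<Rightarrow> 'v cpoly \<Rightarrow> 'a" where
  "poly_value h \<rho> P =
     (\<Sum>m\<in>Poly_Mapping.keys P. h (Poly_Mapping.lookup P m) *
        (\<Prod>v\<in>Poly_Mapping.keys m. \<rho> v ^ Poly_Mapping.lookup m v))"

definition eval_at :: "('v \<Rightarrow> complex) \<Rightarrow> 'v cpoly \<Rightarrow> complex" where
  "eval_at = poly_value (\<lambda>c. c)"

definition subst :: "('v \<Rightarrow> 'w cpoly) \<Rightarrow> 'v cpoly \<Rightarrow> 'w cpoly" where
  "subst = poly_value Const"

text \<open>Partial derivative. The truncated exponent that \<^term>\<open>m - Poly_Mapping.single v 1\<close> has when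
  \<^term>\<open>v\<close> does not occur in \<^term>\<open>m\<close> is harmless: the coefficient is then \<^term>\<open>0\<close>.\<close>

definition pdiff :: "'v \<Rightarrow> 'v cpoly \<Rightarrow> 'v cpoly" where
  "pdiff v P = (\<Sum>m\<in>Poly_Mapping.keys P.
     Poly_Mapping.single (m - Poly_Mapping.single v 1)
       (of_nat (Poly_Mapping.lookup m v) * Poly_Mapping.lookup P m))"

text \<open>\<open>Jet i l\<close> is the variable \<open>f\<^sub>i\<^sup>(\<^sup>l\<^sup>)\<close>. The lexicographic order on jet variables has no
  mathematical content; it is there because the library derives that polynomials
  form an integral domain (needed for their fraction field) from an order on the variables.\<close>

datatype jet_var = Jet (component: nat) (jet_order: nat)

instantiation jet_var :: linorder
begin

definition less_eq_jet_var :: "jet_var \<Rightarrow> jet_var \<Rightarrow> bool" where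
  "x \<le> y \<longleftrightarrow> component x < component y \<or>
     (component x = component y \<and> jet_order x \<le> jet_order y)"

definition less_jet_var :: "jet_var \<Rightarrow> jet_var \<Rightarrow> bool" where
  "x < y \<longleftrightarrow> component x < component y \<or>
     (component x = component y \<and> jet_order x < jet_order y)"

instance
  by standard (auto simp: less_eq_jet_var_def less_jet_var_def intro: jet_var.expand)

end

definition jet_vars :: "nat \<Rightarrow> nat \<Rightarrow> jet_var set" where
  "jet_vars n \<kappa> = {Jet i l | i l. 1 \<le> i \<and> i \<le> n \<and> 1 \<le> l \<and> l \<le> \<kappa>}"

definition jet_polys :: "nat \<Rightarrow> nat \<Rightarrow> jet_var cpoly set" where
  "jet_polys n \<kappa> = {P. vars P \<subseteq> jet_vars n \<kappa>}"

definition jet :: "(nat \<Rightarrow> complex \<Rightarrow> complex) \<Rightarrow> complex \<Rightarrow> jet_var \<Rightarrow> complex" where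
  "jet f z v = (deriv ^^ jet_order v) (f (component v)) z"

definition local_biholomorphism :: "(complex \<Rightarrow> complex) \<Rightarrow> bool" where
  "local_biholomorphism \<phi> \<longleftrightarrow> \<phi> 0 = 0 \<and>
     (\<exists>U \<psi>. open U \<and> 0 \<in> U \<and> open (\<phi> ` U) \<and> \<phi> holomorphic_on U \<and>
        \<psi> holomorphic_on (\<phi> ` U) \<and> (\<forall>z\<in>U. \<psi> (\<phi> z) = z))"

text \<open>The defining identity is one between germs at the origin, i.e.\ it holds at all points close
  to \<^term>\<open>0 :: complex\<close>.\<close>

definition reparam_invariant :: "nat \<Rightarrow> nat \<Rightarrow> jet_var cpoly \<Rightarrow> bool" where
  "reparam_invariant n m P \<longleftrightarrow>
     (\<forall>f \<phi>. (\<forall>i\<in>{1..n}. f i analytic_on {0}) \<longrightarrow> local_biholomorphism \<phi> \<longrightarrow>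
        (\<forall>\<^sub>F z in nhds 0. eval_at (jet (\<lambda>i. f i \<circ> \<phi>) z) P
                         = deriv \<phi> z ^ m * eval_at (jet f (\<phi> z)) P))"

definition unipotent_action :: "(nat \<Rightarrow> nat \<Rightarrow> complex) \<Rightarrow> jet_var \<Rightarrow> jet_var cpoly" where
  "unipotent_action u v =
     Var v + (\<Sum>j\<in>{1..<component v}. Const (u (component v) j) * Var (Jet j (jet_order v)))"

text \<open>A lower triangular unipotent matrix is given by its entries \<open>u i j\<close> with
  \<open>1 \<le> j < i \<le> n\<close>, which are arbitrary; no other value of \<open>u\<close> is used.\<close>

definition unipotent_invariant :: "jet_var cpoly \<Rightarrow> bool" where
  "unipotent_invariant P \<longleftrightarrow> (\<forall>u. subst (unipotent_action u) P = P)"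

definition UE :: "nat \<Rightarrow> nat \<Rightarrow> nat \<Rightarrow> jet_var cpoly set" where
  "UE n \<kappa> m = {P \<in> jet_polys n \<kappa>. reparam_invariant n m P \<and> unipotent_invariant P}"

definition D :: "jet_var cpoly \<Rightarrow> jet_var cpoly" where
  "D P = (\<Sum>v\<in>vars P. Var (Jet (component v) (Suc (jet_order v))) * pdiff v P)"

definition bracket ::
  "nat \<Rightarrow> nat \<Rightarrow> jet_var cpoly \<Rightarrow> jet_var cpoly \<Rightarrow> jet_var cpoly" where
  "bracket p q P Q = of_nat q * D P * Q - of_nat p * P * D Q"

text \<open>\<open>Lam i l\<close> is \<open>\<Lambda>\<^sub>1\<^sub>,\<^sub>i\<close> of weight \<open>2 l - 1\<close>, for \<open>l \<ge> 2\<close>; it is left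
  unspecified for smaller \<open>l\<close>.\<close>

fun Lam :: "nat \<Rightarrow> nat \<Rightarrow> jet_var cpoly" where
  "Lam i (Suc (Suc 0)) = bracket 1 1 (Var (Jet i 1)) (Var (Jet 1 1))"
| "Lam i (Suc (Suc (Suc l))) =
     bracket (2 * Suc (Suc l) - 1) 1 (Lam i (Suc (Suc l))) (Var (Jet 1 1))"

text \<open>The determinants are indexed by \<open>n\<^sub>1\<close> together with \<open>\<lambda>\<^sub>2, \<dots>, \<lambda>\<close> up to
  subscript \<open>n\<^sub>1\<close>. Matrix positions are counted from \<open>0\<close>, whereas the columns and the
  subscripts of \<open>\<lambda>\<close> start at \<open>2\<close>.\<close>

type_synonym minor_index = "nat \<times> (nat \<Rightarrow> nat)"

definition minor_indices :: "nat \<Rightarrow> nat \<Rightarrow> minor_index set" where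
  "minor_indices n \<kappa> = (SIGMA n\<^sub>1:{2..n}. {2..n\<^sub>1} \<rightarrow>\<^sub>E {2..\<kappa>})"

definition Lam_minor :: "minor_index \<Rightarrow> jet_var cpoly" where
  "Lam_minor = (\<lambda>(n\<^sub>1, ls).
     Determinant.det (Matrix.mat (n\<^sub>1 - 1) (n\<^sub>1 - 1) (\<lambda>(r, c). Lam (c + 2) (ls (r + 2)))))"

end

(*  At a jet with f_1' non-zero, reparametrising by the local inverse of f_1 and applying a unipotent
    matrix brings f to the form f_1 = id, f_i' = 0; the higher derivatives of f_i then are
    Lam i l / f_1'^(2l-1). Hence BP is f_1'^m times a polynomial Q in these quotients, and Q is
    invariant under unipotent row operations. Such a Q is a polynomial in the minors on the
    first rows (first fundamental theorem for the unipotent group), which follows from Capelli's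
    identity: up to a non-zero factor, a row-homogeneous invariant f equals
    sum_k det(X_k) Omega_k f, with Omega_k f invariant of lower degree. The bounds for the
    exponents of f_1' come from the homogeneity of BP.
*)
theory Submission
  imports Defs
begin

section \<open>Polynomials\<close>

text \<open>The fundamental theorem alone does not bound \<open>a\<close>. Minors satisfy polynomial
  relations, so a polynomial in them that represents Q may contain terms of high degree that cancel.
  The theorem is therefore proved with a weight bound on the representing polynomial, the jet
  variable of order l having weight l. Setting f_1' = 1 destroys homogeneity, so the weight of Q is
  merely at most m. A quotient of weight l has the denominator f_1'^(2l-1), and (2l-1)/l = 2 - 1/l
  is at most 2 - 1/\<kappa>. The pole order thus lies between 0 and (2 - 1/\<kappa>)m; subtracting
  it from the exponent m of the prefactor leaves m as upper and -(\<kappa>-1)m/\<kappa> as lower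
  bound. Invariance is a statement about germs, whereas the argument takes place at points of jet
  space: every jet is realised by a polynomial curve, and polynomial identities are checked
  pointwise. In the fundamental theorem invariance is used infinitesimally, as a system of
  differential equations.\<close>

abbreviation coef :: "('k \<Rightarrow>\<^sub>0 'b::zero) \<Rightarrow> 'k \<Rightarrow> 'b" where
  "coef \<equiv> Poly_Mapping.lookup"

abbreviation supp :: "('k \<Rightarrow>\<^sub>0 'b::zero) \<Rightarrow> 'k set" where
  "supp \<equiv> Poly_Mapping.keys"

abbreviation sing :: "'k \<Rightarrow> 'b::zero \<Rightarrow> 'k \<Rightarrow>\<^sub>0 'b" where
  "sing \<equiv> Poly_Mapping.single"

definition mono_value :: "('v \<Rightarrow> 'a::comm_ring_1) \<Rightarrow> ('v \<Rightarrow>\<^sub>0 nat) \<Rightarrow> 'a" where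
  "mono_value \<rho> m = (\<Prod>v\<in>supp m. \<rho> v ^ coef m v)"

lemma mono_value_superset:
  assumes "finite S" "supp m \<subseteq> S"
  shows "mono_value \<rho> m = (\<Prod>v\<in>S. \<rho> v ^ coef m v)"
  unfolding mono_value_def
  by (rule prod.mono_neutral_left[OF assms]) (auto simp: in_keys_iff)

lemma mono_value_0 [simp]: "mono_value \<rho> 0 = 1"
  by (simp add: mono_value_def)

lemma supp_add_nat: "supp (m + m' :: 'v \<Rightarrow>\<^sub>0 nat) = supp m \<union> supp m'"
  by (auto simp: in_keys_iff lookup_add)

lemma mono_value_add: "mono_value \<rho> (m + m') = mono_value \<rho> m * mono_value \<rho> m'"
proof -
  let ?S = "supp m \<union> supp m'"
  have "mono_value \<rho> (m + m') = (\<Prod>v\<in>?S. \<rho> v ^ coef (m + m') v)"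
    by (rule mono_value_superset) (auto simp: supp_add_nat)
  also have "\<dots> = (\<Prod>v\<in>?S. \<rho> v ^ coef m v) * (\<Prod>v\<in>?S. \<rho> v ^ coef m' v)"
    by (simp add: lookup_add power_add prod.distrib)
  also have "\<dots> = mono_value \<rho> m * mono_value \<rho> m'"
    by (subst (1 2) mono_value_superset[where S = ?S]) auto
  finally show ?thesis .
qed

lemma mono_value_sing [simp]: "mono_value \<rho> (sing v k) = \<rho> v ^ k"
  by (subst mono_value_superset[of "{v}"]) (auto simp: lookup_single)

lemma poly_value_eq: "poly_value h \<rho> P = (\<Sum>m\<in>supp P. h (coef P m) * mono_value \<rho> m)"
  by (simp add: poly_value_def mono_value_def)

lemma poly_value_superset:
  assumes "finite S" "supp P \<subseteq> S" "h 0 = 0"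
  shows "poly_value h \<rho> P = (\<Sum>m\<in>S. h (coef P m) * mono_value \<rho> m)"
  unfolding poly_value_eq
  by (rule sum.mono_neutral_left[OF assms(1,2)]) (auto simp: in_keys_iff assms(3))

text \<open>Polynomials and exponent vectors are both finitely supported maps, so this rule serves
  at both levels.\<close>

lemma sing_induct [case_names sing add]:
  fixes P :: "'k \<Rightarrow>\<^sub>0 'b::comm_monoid_add"
  assumes "\<And>m c. R (sing m c)" and "\<And>P Q. R P \<Longrightarrow> R Q \<Longrightarrow> R (P + Q)"
  shows "R P"
proof (induction P rule: update_induct)
  case const
  show ?case using assms(1)[of undefined 0] by simp
next
  case (update f a b)
  have "Poly_Mapping.update a b f = f + sing a b"
    using update by (intro poly_mapping_eqI) (auto simp: lookup_update lookup_add lookup_single in_keys_iff when_def)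
  then show ?case using update assms by metis
qed

section \<open>Constants, variables, and the homomorphisms they determine\<close>

lemma Const_add: "Const (a + b) = Const a + Const b"
  by (simp add: Const_def single_add)

lemma Const_mult: "Const (a * b) = Const a * Const b"
  by (simp add: Const_def mult_single)

lemma Const_0 [simp]: "Const 0 = 0"
  by (simp add: Const_def)

lemma Const_1 [simp]: "Const 1 = 1"
  by (simp add: Const_def)

lemma Const_uminus: "Const (- a) = - Const a"
  by (simp add: Const_def single_uminus)

lemma Const_diff: "Const (a - b) = Const a - Const b"
  by (simp add: Const_def single_diff)

lemma Const_of_nat: "Const (of_nat k) = of_nat k"
  by (induction k) (simp_all add: Const_add)

lemma Var_power: "Var v ^ k = sing (sing v k) 1"
  by (induction k) (simp_all add: Var_def mult_single flip: single_add)

text \<open>Constants and variables generate the ring. Identities between homomorphisms or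
  derivations need checking only on these generators, without looking at monomials.\<close>

lemma cpoly_induct [case_names Const Var add mult]:
  assumes "\<And>c. R (Const c)" "\<And>v. R (Var v)"
    and "\<And>P Q. R P \<Longrightarrow> R Q \<Longrightarrow> R (P + Q)" "\<And>P Q. R P \<Longrightarrow> R Q \<Longrightarrow> R (P * Q)"
  shows "R P"
proof (induction P rule: sing_induct)
  case (sing m c)
  have R1: "R (sing (sing v k) 1)" for v k
  proof (induction k)
    case 0
    show ?case using assms(1)[of 1] by simp
  next
    case (Suc k)
    have "R (Var v * Var v ^ k)" by (intro assms) (use Suc in \<open>simp add: Var_power\<close>)
    then show ?case by (metis Var_power power_Suc)
  qed
  have "R (sing m 1)"
  proof (induction m rule: sing_induct)
    case (sing m c)
    show ?case by (rule R1)
  next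
    case (add P Q)
    then have "R (sing P 1 * sing Q 1)" by (intro assms)
    then show ?case by (simp add: mult_single)
  qed
  then have "R (Const c * sing m 1)" by (intro assms)
  then show ?case by (simp add: Const_def mult_single)
qed (rule assms)

text \<open>Evaluation at a point and substitution differ only in how coefficients enter the target
  ring; both inherit the homomorphism laws from here.\<close>

locale scalar_hom =
  fixes h :: "complex \<Rightarrow> 'a::comm_ring_1"
  assumes h_add: "h (a + b) = h a + h b" and h_mult: "h (a * b) = h a * h b" and h_1: "h 1 = 1"
begin

lemma h_0: "h 0 = 0"
  using h_add[of 0 0] by simp

lemma poly_value_sing: "poly_value h \<rho> (sing m c) = h c * mono_value \<rho> m"
  by (subst poly_value_superset[of "{m}"]) (auto simp: h_0)

lemma poly_value_0: "poly_value h \<rho> 0 = 0"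
  by (simp add: poly_value_def)

lemma poly_value_add: "poly_value h \<rho> (P + Q) = poly_value h \<rho> P + poly_value h \<rho> Q"
proof -
  have "supp (P + Q) \<subseteq> supp P \<union> supp Q"
    by (rule Poly_Mapping.keys_add)
  then show ?thesis
    by (subst (1 2 3) poly_value_superset[of "supp P \<union> supp Q"])
      (auto simp: lookup_add h_add h_0 algebra_simps sum.distrib)
qed

lemma poly_value_mult: "poly_value h \<rho> (P * Q) = poly_value h \<rho> P * poly_value h \<rho> Q"
proof (induction P rule: sing_induct)
  case (sing m c)
  show ?case
    by (induction Q rule: sing_induct)
      (simp_all add: mult_single poly_value_sing h_mult mono_value_add poly_value_add algebra_simps)
qed (simp add: poly_value_add algebra_simps)

lemma poly_value_Const: "poly_value h \<rho> (Const c) = h c"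
  by (simp add: Const_def poly_value_sing)

lemma poly_value_Var: "poly_value h \<rho> (Var v) = \<rho> v"
  by (simp add: Var_def poly_value_sing h_1)

lemma poly_value_1: "poly_value h \<rho> 1 = 1"
  using poly_value_Const[of \<rho> 1] by (simp add: h_1)

lemma poly_value_uminus: "poly_value h \<rho> (- P) = - poly_value h \<rho> P"
  using poly_value_add[of \<rho> P "- P"]
  by (simp add: eq_neg_iff_add_eq_0 add.commute poly_value_0)

lemma poly_value_diff: "poly_value h \<rho> (P - Q) = poly_value h \<rho> P - poly_value h \<rho> Q"
  using poly_value_add[of \<rho> P "- Q"] by (simp add: poly_value_uminus)

lemma poly_value_of_nat: "poly_value h \<rho> (of_nat k) = of_nat k"
  by (induction k) (simp_all add: poly_value_add poly_value_0 poly_value_1)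

lemma poly_value_of_int: "poly_value h \<rho> (of_int k) = of_int k"
  by (cases k) (simp_all add: poly_value_uminus poly_value_diff poly_value_1 poly_value_of_nat)

lemma poly_value_power: "poly_value h \<rho> (P ^ k) = poly_value h \<rho> P ^ k"
  by (induction k) (simp_all add: poly_value_mult poly_value_1)

lemma poly_value_sum: "poly_value h \<rho> (sum F A) = (\<Sum>a\<in>A. poly_value h \<rho> (F a))"
  by (induction A rule: infinite_finite_induct) (simp_all add: poly_value_add poly_value_0)

lemma poly_value_prod: "poly_value h \<rho> (prod F A) = (\<Prod>a\<in>A. poly_value h \<rho> (F a))"
  by (induction A rule: infinite_finite_induct) (simp_all add: poly_value_mult poly_value_1)

lemmas poly_value_simps =
  poly_value_add poly_value_mult poly_value_uminus poly_value_diff poly_value_power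
  poly_value_sum poly_value_prod

end

interpretation eval_hom: scalar_hom "\<lambda>c. c"
  by unfold_locales (rule refl)+

interpretation subst_hom: scalar_hom "Const :: complex \<Rightarrow> 'v cpoly"
  by unfold_locales (rule Const_add Const_mult Const_1)+

lemmas eval_at_simps [simp] = eval_hom.poly_value_simps[folded eval_at_def]
  eval_hom.poly_value_Const[folded eval_at_def] eval_hom.poly_value_Var[folded eval_at_def]
  eval_hom.poly_value_0[folded eval_at_def] eval_hom.poly_value_1[folded eval_at_def]
  eval_hom.poly_value_of_nat[folded eval_at_def] eval_hom.poly_value_of_int[folded eval_at_def]

lemmas subst_simps [simp] = subst_hom.poly_value_simps[folded subst_def]
  subst_hom.poly_value_Const[folded subst_def] subst_hom.poly_value_Var[folded subst_def]
  subst_hom.poly_value_0[folded subst_def] subst_hom.poly_value_1[folded subst_def]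
  subst_hom.poly_value_of_nat[folded subst_def] subst_hom.poly_value_of_int[folded subst_def]

lemma eval_at_eq_sum: "eval_at x P = (\<Sum>m\<in>supp P. coef P m * mono_value x m)"
  by (simp add: eval_at_def poly_value_eq)

lemma subst_eq_sum: "subst s P = (\<Sum>m\<in>supp P. Const (coef P m) * mono_value s m)"
  by (simp add: subst_def poly_value_eq)

lemma eval_at_subst: "eval_at x (subst s P) = eval_at (\<lambda>v. eval_at x (s v)) P"
  by (induction P rule: cpoly_induct) simp_all

lemma eval_at_cong:
  assumes "\<And>v. v \<in> vars P \<Longrightarrow> x v = y v"
  shows "eval_at x P = eval_at y P"
  unfolding eval_at_def poly_value_def using assms
  by (intro sum.cong arg_cong2[where f = "(*)"] prod.cong refl arg_cong2[where f = power]) (auto simp: vars_def)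

lemma finite_vars [simp]: "finite (vars P)"
  by (simp add: vars_def)

lemma vars_Const [simp]: "vars (Const c) = {}"
  by (auto simp: vars_def Const_def split: if_splits)

lemma vars_0 [simp]: "vars 0 = {}"
  by (auto simp: vars_def)

lemma vars_Var [simp]: "vars (Var v) = {v}"
  by (auto simp: vars_def Var_def)

lemma vars_1 [simp]: "vars 1 = {}"
  by (simp flip: Const_1)

lemma Var_neq_0 [simp]: "Var v \<noteq> 0"
proof
  assume "Var v = 0"
  then have "vars (Var v) = {}" by (simp only: vars_0)
  then show False by simp
qed

lemma vars_of_nat [simp]: "vars (of_nat k) = {}"
  by (simp flip: Const_of_nat)

lemma vars_add: "vars (P + Q) \<subseteq> vars P \<union> vars Q"
  unfolding vars_def using Poly_Mapping.keys_add[of P Q] by blast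

lemma vars_uminus [simp]: "vars (- P) = vars P"
  by (auto simp: vars_def in_keys_iff)

lemma vars_diff: "vars (P - Q) \<subseteq> vars P \<union> vars Q"
  using vars_add[of P "- Q"] by simp

lemma vars_mult: "vars (P * Q) \<subseteq> vars P \<union> vars Q"
proof
  fix v assume "v \<in> vars (P * Q)"
  then obtain m where m: "m \<in> supp (P * Q)" "v \<in> supp m" by (auto simp: vars_def)
  then obtain a b where "m = a + b" "a \<in> supp P" "b \<in> supp Q"
    using keys_mult[of P Q] by blast
  then show "v \<in> vars P \<union> vars Q" using m by (auto simp: vars_def supp_add_nat)
qed

lemma vars_sum: "vars (sum F A) \<subseteq> (\<Union>a\<in>A. vars (F a))"
  by (induction A rule: infinite_finite_induct) (use vars_add in fastforce)+

section \<open>Partial derivatives, coefficient by coefficient\<close>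

lemma coef_pdiff: "coef (pdiff v P) m = of_nat (Suc (coef m v)) * coef P (m + sing v 1)"
proof -
  have *: "coef (sing (k - sing v 1) (of_nat (coef k v) * coef P k)) m =
      (if k = m + sing v 1 then of_nat (Suc (coef m v)) * coef P k else 0)" for k
  proof (cases "coef k v = 0")
    case True
    then have "k \<noteq> m + sing v 1" by (auto simp: lookup_add)
    then show ?thesis using True by simp
  next
    case False
    then have "k - sing v 1 + sing v 1 = k"
      by (intro poly_mapping_eqI) (auto simp: lookup_add lookup_minus lookup_single when_def)
    then have "k - sing v 1 = m \<longleftrightarrow> k = m + sing v 1"
      by (metis add_diff_cancel_right')
    then show ?thesis by (auto simp: lookup_single lookup_add when_def)
  qed
  show ?thesis
    unfolding pdiff_def lookup_sum * by (auto simp: in_keys_iff)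
qed

lemma coef_Var_mult: "coef (Var v * P) m = (if coef m v = 0 then 0 else coef P (m - sing v 1))"
proof (induction P rule: sing_induct)
  case (sing k c)
  have *: "Var v * sing k c = sing (k + sing v 1) c"
    by (simp add: Var_def mult_single add.commute)
  show ?case
  proof (cases "coef m v = 0")
    case True
    then have "k + sing v 1 \<noteq> m" by (auto simp: lookup_add)
    then show ?thesis using True by (simp add: * lookup_single)
  next
    case False
    then have "m - sing v 1 + sing v 1 = m"
      by (intro poly_mapping_eqI) (auto simp: lookup_add lookup_minus lookup_single when_def)
    then have "m - sing v 1 = k \<longleftrightarrow> k + sing v 1 = m"
      by (metis add_diff_cancel_right')
    then show ?thesis using False by (auto simp: * lookup_single when_def)
  qed
qed (auto simp: lookup_add algebra_simps)

lemma coef_Const_mult: "coef (Const c * P) m = c * coef P m"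
  by (induction P rule: sing_induct)
    (auto simp: Const_def mult_single lookup_single lookup_add algebra_simps when_def)

lemma pdiff_add: "pdiff v (P + Q) = pdiff v P + pdiff v Q"
  by (intro poly_mapping_eqI) (simp add: coef_pdiff lookup_add algebra_simps)

lemma pdiff_0 [simp]: "pdiff v 0 = 0"
  by (simp add: pdiff_def)

lemma pdiff_sum: "pdiff v (sum F A) = (\<Sum>a\<in>A. pdiff v (F a))"
  by (induction A rule: infinite_finite_induct) (simp_all add: pdiff_add)

lemma pdiff_Const [simp]: "pdiff v (Const c) = 0"
  by (intro poly_mapping_eqI) (auto simp: coef_pdiff Const_def lookup_single when_def
      dest: arg_cong[of _ _ "\<lambda>m. coef m v"] simp: lookup_add)

lemma pdiff_Const_mult: "pdiff v (Const c * P) = Const c * pdiff v P"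
  by (intro poly_mapping_eqI) (simp add: coef_pdiff coef_Const_mult)

lemma pdiff_Var_mult:
  fixes P :: "'v cpoly"
  shows "pdiff v (Var w * P) = (if v = w then P else 0) + Var w * pdiff v P"
proof (intro poly_mapping_eqI)
  fix m :: "'v \<Rightarrow>\<^sub>0 nat"
  have "m + sing w 1 - sing w 1 = m" by simp
  moreover have "coef m w \<noteq> 0 \<Longrightarrow> m + sing v 1 - sing w 1 = m - sing w 1 + sing v 1"
    by (intro poly_mapping_eqI) (auto simp: lookup_add lookup_minus lookup_single when_def)
  moreover have "coef m v \<noteq> 0 \<Longrightarrow> Suc (coef (m - sing v 1) v) = coef m v"
    by (auto simp: lookup_minus)
  moreover have "coef m v \<noteq> 0 \<Longrightarrow> m - sing v 1 + sing v 1 = m"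
    by (intro poly_mapping_eqI) (auto simp: lookup_add lookup_minus lookup_single when_def)
  ultimately show "coef (pdiff v (Var w * P)) m = coef ((if v = w then P else 0) + Var w * pdiff v P) m"
    by (auto simp: coef_pdiff coef_Var_mult lookup_add lookup_minus lookup_single distrib_right
        left_diff_distrib)
qed

lemma pdiff_Var [simp]: "pdiff v (Var w) = (if v = w then 1 else 0)"
  using pdiff_Var_mult[of v w 1] pdiff_Const[of v 1] by simp

lemma pdiff_mult: "pdiff v (P * Q) = pdiff v P * Q + P * pdiff v Q"
proof (induction P arbitrary: Q rule: cpoly_induct)
  case (mult P P')
  show ?case by (simp add: mult algebra_simps)
qed (simp_all add: pdiff_Const_mult pdiff_Var_mult pdiff_add distrib_right add_ac)

lemma pdiff_commute: "pdiff v (pdiff w P) = pdiff w (pdiff v P)"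
proof (intro poly_mapping_eqI)
  fix m
  show "coef (pdiff v (pdiff w P)) m = coef (pdiff w (pdiff v P)) m"
    by (cases "v = w") (auto simp: coef_pdiff lookup_add lookup_single algebra_simps)
qed

lemma pdiff_notin_vars:
  fixes P :: "'v cpoly"
  assumes "v \<notin> vars P"
  shows "pdiff v P = 0"
proof (intro poly_mapping_eqI)
  fix m :: "'v \<Rightarrow>\<^sub>0 nat"
  have "v \<in> supp (m + sing v 1)" by (simp add: supp_add_nat)
  then have "m + sing v 1 \<notin> supp P" using assms by (auto simp: vars_def)
  then show "coef (pdiff v P) m = coef 0 m"
    by (simp add: coef_pdiff in_keys_iff)
qed

lemma supp_pdiff: "m \<in> supp (pdiff v P) \<Longrightarrow> m + sing v 1 \<in> supp P"
  by (auto simp: in_keys_iff coef_pdiff)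

lemma vars_pdiff: "vars (pdiff v P) \<subseteq> vars P"
  by (auto simp: vars_def supp_add_nat dest: supp_pdiff)

text \<open>Monomials are eigenvectors of the Euler operator, with the exponent as eigenvalue. This
  turns differential equations into conditions on the degrees of monomials.\<close>

lemma coef_Euler: "coef (Var v * pdiff v P) m = of_nat (coef m v) * coef P m"
proof (cases "coef m v = 0")
  case False
  then have "m - sing v 1 + sing v 1 = m"
    by (intro poly_mapping_eqI) (auto simp: lookup_add lookup_minus lookup_single when_def)
  moreover have "Suc (coef (m - sing v 1) v) = coef m v" using False by (simp add: lookup_minus)
  ultimately show ?thesis using False by (simp only: coef_Var_mult coef_pdiff if_False)
qed (simp add: coef_Var_mult)

text \<open>The bridge from invariance under a one-parameter family to an algebraic differential
  equation, by differentiating along the family.\<close>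

lemma has_field_derivative_eval_at:
  assumes "finite V" "vars P \<subseteq> V"
    and "\<And>v. v \<in> V \<Longrightarrow> ((\<lambda>t. \<gamma> t v) has_field_derivative \<gamma>' v) (at t)"
  shows "((\<lambda>t. eval_at (\<gamma> t) P) has_field_derivative
    (\<Sum>v\<in>V. \<gamma>' v * eval_at (\<gamma> t) (pdiff v P))) (at t)"
proof -
  \<comment> \<open>The induction passes through polynomials whose variables need not lie in
    \<open>V\<close>; freezing the other coordinates at 0 makes the formula true for all of
    them.\<close>
  define \<delta> where "\<delta> s v = (if v \<in> V then \<gamma> s v else 0)" for s v
  have "((\<lambda>t. eval_at (\<delta> t) P) has_field_derivative
    (\<Sum>v\<in>V. \<gamma>' v * eval_at (\<delta> t) (pdiff v P))) (at t)"
  proof (induction P rule: cpoly_induct)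
    case (Const c)
    show ?case by simp
  next
    case (Var w)
    show ?case
    proof (cases "w \<in> V")
      case True
      then have "(\<Sum>v\<in>V. \<gamma>' v * eval_at (\<delta> t) (pdiff v (Var w))) = (\<Sum>v\<in>V. if v = w then \<gamma>' v else 0)"
        by (intro sum.cong) auto
      also have "\<dots> = \<gamma>' w" using assms True by simp
      finally have "(\<Sum>v\<in>V. \<gamma>' v * eval_at (\<delta> t) (pdiff v (Var w))) = \<gamma>' w" .
      moreover have "((\<lambda>t. \<delta> t w) has_field_derivative \<gamma>' w) (at t)"
        using assms True by (simp add: \<delta>_def)
      ultimately show ?thesis by simp
    next
      case False
      then have "(\<Sum>v\<in>V. \<gamma>' v * eval_at (\<delta> t) (pdiff v (Var w))) = 0"
        by (intro sum.neutral) auto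
      moreover have "(\<lambda>t. \<delta> t w) = (\<lambda>t. 0)" using False by (simp add: \<delta>_def)
      ultimately show ?thesis by simp
    qed
  next
    case (add P Q)
    from DERIV_add[OF this] show ?case
      by (simp add: pdiff_add algebra_simps sum.distrib)
  next
    case (mult P Q)
    from DERIV_mult[OF this] show ?case
      by (simp add: pdiff_mult algebra_simps sum.distrib sum_distrib_left sum_distrib_right)
  qed
  moreover have "eval_at (\<delta> s) P = eval_at (\<gamma> s) P" for s
    by (rule eval_at_cong) (use assms(2) in \<open>auto simp: \<delta>_def\<close>)
  moreover have "eval_at (\<delta> t) (pdiff v P) = eval_at (\<gamma> t) (pdiff v P)" for v
    by (rule eval_at_cong) (use assms(2) vars_pdiff[of v P] in \<open>auto simp: \<delta>_def\<close>)
  ultimately show ?thesis by simp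
qed

section \<open>Weighted degrees, and polynomials that vanish as functions\<close>

definition wdeg :: "('v \<Rightarrow> nat) \<Rightarrow> ('v \<Rightarrow>\<^sub>0 nat) \<Rightarrow> nat" where
  "wdeg w m = (\<Sum>v\<in>supp m. coef m v * w v)"

lemma wdeg_superset: "finite S \<Longrightarrow> supp m \<subseteq> S \<Longrightarrow> wdeg w m = (\<Sum>v\<in>S. coef m v * w v)"
  unfolding wdeg_def by (rule sum.mono_neutral_left) (auto simp: in_keys_iff)

lemma wdeg_0 [simp]: "wdeg w 0 = 0"
  by (simp add: wdeg_def)

lemma wdeg_add: "wdeg w (m + m') = wdeg w m + wdeg w m'"
  by (subst (1 2 3) wdeg_superset[of "supp m \<union> supp m'"])
    (auto simp: supp_add_nat lookup_add algebra_simps sum.distrib)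

lemma wdeg_sing [simp]: "wdeg w (sing v k) = k * w v"
  by (subst wdeg_superset[of "{v}"]) auto

text \<open>If a polynomial vanishes at every point, so do its partial derivatives, which have
  smaller degree. These are zero by induction, so only the constant term can survive, and evaluation
  at the origin removes it.\<close>

lemma eval_at_eq_0_iff: "(\<forall>x. eval_at x P = 0) \<longleftrightarrow> P = 0"
proof
  define d where "d = (\<Sum>m\<in>supp P. wdeg (\<lambda>_. 1) m)"
  have "\<forall>m\<in>supp P. wdeg (\<lambda>_. 1) m \<le> d"
    unfolding d_def by (auto intro: member_le_sum)
  moreover assume "\<forall>x. eval_at x P = 0"
  ultimately show "P = 0"
  proof (induction d arbitrary: P rule: less_induct)
    case (less d)
    have *: "pdiff v P = 0" for v
    proof (cases "v \<in> vars P")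
      case True
      have "d > 0"
      proof -
        obtain m where m: "m \<in> supp P" "v \<in> supp m" using True by (auto simp: vars_def)
        then have "0 < coef m v" by (simp add: in_keys_iff)
        also have "\<dots> \<le> wdeg (\<lambda>_. 1) m"
          unfolding wdeg_def using m by (auto intro!: member_le_sum[of v "supp m" "coef m"])
        finally show ?thesis using less.prems(1) m by fastforce
      qed
      moreover have "\<forall>m\<in>supp (pdiff v P). wdeg (\<lambda>_. 1) m \<le> d - 1"
        using less.prems(1) by (force dest!: supp_pdiff simp: wdeg_add)
      moreover have "\<forall>x. eval_at x (pdiff v P) = 0"
      proof
        fix x
        have "((\<lambda>t. eval_at (x(v := t)) P) has_field_derivative
          (\<Sum>w\<in>vars P. (if w = v then 1 else 0) * eval_at (x(v := x v)) (pdiff w P))) (at (x v))"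
          by (rule has_field_derivative_eval_at) auto
        moreover have "(\<Sum>w\<in>vars P. (if w = v then 1 else 0) * eval_at (x(v := x v)) (pdiff w P)) =
          eval_at x (pdiff v P)"
          using True by (simp add: if_distrib[of "\<lambda>c. c * _"] cong: if_cong)
        ultimately have "((\<lambda>t. 0) has_field_derivative eval_at x (pdiff v P)) (at (x v))"
          using less.prems(2) by simp
        then show "eval_at x (pdiff v P) = 0"
          using DERIV_const DERIV_unique by blast
      qed
      ultimately show ?thesis using less.IH[of "d - 1"] by simp
    qed (rule pdiff_notin_vars)
    have "coef P m = 0" if "m \<noteq> 0" for m
    proof -
      obtain v where "coef m v \<noteq> 0"
        using \<open>m \<noteq> 0\<close> by (metis poly_mapping_eqI lookup_zero)
      then show ?thesis using coef_Euler[of v P m] * by simp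
    qed
    then have "P = Const (coef P 0)"
      by (intro poly_mapping_eqI) (auto simp: Const_def lookup_single when_def)
    moreover have "eval_at (\<lambda>_. 0) P = 0" using less.prems by blast
    ultimately show "P = 0" by (metis Const_0 eval_at_simps(8))
  qed
qed simp

lemma cpoly_eqI: "(\<And>x. eval_at x P = eval_at x Q) \<Longrightarrow> P = Q"
  using eval_at_eq_0_iff[of "P - Q"] by simp

section \<open>Capelli's identity\<close>

lemma sum_PiE_insert:
  assumes "i \<notin> S"
  shows "(\<Sum>k\<in>Pi\<^sub>E (insert i S) (\<lambda>_. L). F k) = (\<Sum>l\<in>L. \<Sum>k\<in>Pi\<^sub>E S (\<lambda>_. L). F (k(i := l)))"
  unfolding PiE_insert_eq
  by (subst sum.reindex[OF inj_combinator[OF assms]])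
    (simp add: sum.cartesian_product case_prod_unfold)

section \<open>Iterated partial derivatives\<close>

definition derivs :: "'v list \<Rightarrow> 'v cpoly \<Rightarrow> 'v cpoly" where
  "derivs = fold pdiff"

lemma derivs_Nil [simp]: "derivs [] f = f"
  and derivs_Cons [simp]: "derivs (v # vs) f = derivs vs (pdiff v f)"
  by (simp_all add: derivs_def)

lemma derivs_pdiff: "derivs vs (pdiff v f) = pdiff v (derivs vs f)"
  by (induction vs arbitrary: f) (simp_all, metis pdiff_commute)

lemma derivs_mset: "mset vs = mset ws \<Longrightarrow> derivs vs f = derivs ws f"
proof (induction vs arbitrary: ws f)
  case (Cons v vs)
  then obtain ws1 ws2 where ws: "ws = ws1 @ v # ws2"
    by (metis list.set_intros(1) set_mset_mset split_list)
  then have "mset vs = mset (ws1 @ ws2)" using Cons.prems by simp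
  then have "derivs (v # vs) f = derivs (ws1 @ ws2) (pdiff v f)" using Cons.IH by simp
  also have "\<dots> = derivs ws f"
    by (simp add: ws derivs_def flip: derivs_pdiff[unfolded derivs_def])
  finally show ?case .
qed simp

lemma pdiff_uminus: "pdiff v (- P) = - pdiff v P"
  by (intro poly_mapping_eqI) (simp add: coef_pdiff)

lemma derivs_uminus: "derivs vs (- f) = - derivs vs f"
  by (induction vs arbitrary: f) (simp_all add: pdiff_uminus)

lemma derivs_0 [simp]: "derivs vs 0 = 0"
  by (induction vs) simp_all

lemma vars_derivs: "vars (derivs vs f) \<subseteq> vars f"
  by (induction vs arbitrary: f) (use vars_pdiff in fastforce)+

text \<open>Each derivative strips its variable off a monomial, so weights drop by exactly the
  weight of \<open>vs\<close>. Membership in the image also shows that nothing survives when that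
  weight exceeds all weights of \<open>f\<close>.\<close>

lemma supp_derivs: "m \<in> supp (derivs vs f) \<Longrightarrow> wdeg w m + sum_list (map w vs) \<in> wdeg w ` supp f"
proof (induction vs arbitrary: f)
  case (Cons v vs)
  then have "wdeg w m + sum_list (map w vs) \<in> wdeg w ` supp (pdiff v f)" by simp
  then obtain m' where "m' \<in> supp (pdiff v f)" "wdeg w m + sum_list (map w vs) = wdeg w m'" by auto
  then show ?case
    by (auto intro!: image_eqI[of _ _ "m' + sing v 1"] simp: wdeg_add dest: supp_pdiff)
qed simp

text \<open>Rows will be components of the curve, columns jet orders. The rows are unbounded, so
  that the number of rows in use can shrink during an induction while the matrix stays
  fixed.\<close>

locale var_matrix =
  fixes X :: "nat \<Rightarrow> nat \<Rightarrow> 'v" and L :: "nat set"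
  assumes X_eq_iff [simp]: "X i k = X j l \<longleftrightarrow> i = j \<and> k = l"
    and finite_L [simp]: "finite L"
begin

text \<open>The infinitesimal form of adding a multiple of row \<open>j\<close> to row
  \<open>i\<close>: the derivative at t = 0 of \<open>f\<close> under X_i \<mapsto> X_i + t X_j.
  Invariance under unipotent row operations thus gives \<open>polar j i f = 0\<close> for
  \<open>j < i\<close>.\<close>

definition polar :: "nat \<Rightarrow> nat \<Rightarrow> 'v cpoly \<Rightarrow> 'v cpoly" where
  "polar j i f = (\<Sum>l\<in>L. Var (X j l) * pdiff (X i l) f)"

text \<open>The normally ordered product of the polarisations \<^term>\<open>polar j i\<close> for \<open>(j, i)\<close> in
  the list: all differentiations precede all multiplications.\<close>

fun normal_prod :: "(nat \<times> nat) list \<Rightarrow> 'v cpoly \<Rightarrow> 'v cpoly" where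
  "normal_prod [] f = f"
| "normal_prod ((j, i) # A) f = (\<Sum>l\<in>L. Var (X j l) * normal_prod A (pdiff (X i l) f))"

lemma normal_prod_Cons:
  "normal_prod (a # A) f = (\<Sum>l\<in>L. Var (X (fst a) l) * normal_prod A (pdiff (X (snd a) l) f))"
  by (cases a) simp

lemma polar_0 [simp]: "polar j i 0 = 0"
  by (simp add: polar_def)

lemma polar_sum: "polar j i (sum F A) = (\<Sum>a\<in>A. polar j i (F a))"
  unfolding polar_def pdiff_sum sum_distrib_left by (rule sum.swap)

lemma polar_Const_mult: "polar j i (Const c * f) = Const c * polar j i f"
  by (simp add: polar_def pdiff_Const_mult sum_distrib_left mult.left_commute)

text \<open>The commutator is non-zero only when the derivative meets the multiplying row
  \<open>j\<close>; all correction terms in Capelli's identity come from this case.\<close>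

lemma pdiff_polar:
  assumes "k \<in> L"
  shows "pdiff (X b k) (polar j i g) = polar j i (pdiff (X b k) g) + (if b = j then pdiff (X i k) g else 0)"
proof -
  have "pdiff (X b k) (polar j i g) =
    (\<Sum>l\<in>L. (if b = j \<and> k = l then pdiff (X i l) g else 0)) + polar j i (pdiff (X b k) g)"
    unfolding polar_def pdiff_sum pdiff_Var_mult sum.distrib
    by (simp add: pdiff_commute[of "X b k"])
  also have "(\<Sum>l\<in>L. (if b = j \<and> k = l then pdiff (X i l) g else 0)) = (if b = j then pdiff (X i k) g else 0)"
    using assms by (auto simp: sum.delta)
  finally show ?thesis by (simp add: add.commute)
qed

lemma normal_prod_add: "normal_prod A (f + g) = normal_prod A f + normal_prod A g"
  by (induction A arbitrary: f g)
    (simp_all add: normal_prod_Cons pdiff_add distrib_left sum.distrib)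

lemma normal_prod_0 [simp]: "normal_prod A 0 = 0"
  by (induction A) (simp_all add: normal_prod_Cons)

lemma normal_prod_Const_mult: "normal_prod A (Const c * f) = Const c * normal_prod A f"
  by (induction A arbitrary: f)
    (simp_all add: normal_prod_Cons pdiff_Const_mult sum_distrib_left mult.left_commute)

text \<open>No correction terms arise, because the multiplications wait until all differentiations
  are done.\<close>

lemma normal_prod_swap: "normal_prod (a # b # A) f = normal_prod (b # a # A) f"
proof (cases a; cases b)
  fix j i j' i' assume ab: "a = (j, i)" "b = (j', i')"
  have "normal_prod (a # b # A) f =
    (\<Sum>l\<in>L. \<Sum>k\<in>L. Var (X j l) * (Var (X j' k) * normal_prod A (pdiff (X i' k) (pdiff (X i l) f))))"
    by (simp add: ab sum_distrib_left)
  also have "\<dots> = (\<Sum>k\<in>L. \<Sum>l\<in>L. Var (X j' k) * (Var (X j l) * normal_prod A (pdiff (X i l) (pdiff (X i' k) f))))"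
    by (subst sum.swap) (simp add: mult.left_commute pdiff_commute)
  finally show ?thesis by (simp add: ab sum_distrib_left)
qed

lemma normal_prod_cong: "(\<And>g. normal_prod A g = normal_prod B g) \<Longrightarrow> normal_prod (a # A) f = normal_prod (a # B) f"
  by (cases a) simp

lemma normal_prod_middle: "normal_prod (A @ a # B) f = normal_prod (a # A @ B) f"
proof (induction A arbitrary: f)
  case (Cons b A)
  have "normal_prod (b # A @ a # B) f = normal_prod (b # a # A @ B) f"
    by (rule normal_prod_cong) (rule Cons.IH)
  then show ?case by (simp only: append_Cons normal_prod_swap)
qed simp

lemma normal_prod_mset: "mset A = mset B \<Longrightarrow> normal_prod A f = normal_prod B f"
proof (induction A arbitrary: B f)
  case (Cons a A)
  then obtain B1 B2 where B: "B = B1 @ a # B2"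
    by (metis list.set_intros(1) set_mset_mset split_list)
  then have "mset A = mset (B1 @ B2)" using Cons.prems by simp
  then have "normal_prod (a # A) f = normal_prod (a # B1 @ B2) f"
    by (intro normal_prod_cong Cons.IH)
  then show ?case by (simp only: B normal_prod_middle)
qed simp

text \<open>No derivative of \<open>A\<close> is taken in row \<open>p\<close>, so none of them
  meets the factors \<open>Var (X p l)\<close> of the polarisation, which can be moved
  outside.\<close>

lemma normal_prod_polar:
  assumes "p \<notin> snd ` set A"
  shows "normal_prod A (polar p i f) = normal_prod ((p, i) # A) f"
  using assms
proof (induction A arbitrary: f)
  case (Cons a A)
  obtain j b where a: "a = (j, b)" by (cases a)
  have "normal_prod (a # A) (polar p i f) = (\<Sum>k\<in>L. Var (X j k) * normal_prod A (polar p i (pdiff (X b k) f)))"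
    using Cons.prems by (auto simp: a pdiff_polar intro!: sum.cong)
  also have "\<dots> = normal_prod (a # (p, i) # A) f"
    using Cons.prems by (simp only: a normal_prod.simps(2)[of j] Cons.IH) (simp add: Cons.IH)
  finally show ?case by (simp only: normal_prod_swap)
qed (simp add: polar_def)

text \<open>Applying the product for \<open>(j, p) # A\<close> to the vanishing
  \<open>polar p i f\<close> produces two terms: the normally ordered one, and the one in which the
  derivative in row \<open>p\<close> hits the factor from row \<open>p\<close>. The latter
  short-circuits the passage through \<open>p\<close> to \<open>(j, i)\<close>.\<close>

lemma normal_prod_transpose:
  assumes "polar p i f = 0" "p \<noteq> i" "p \<notin> snd ` set A"
  shows "normal_prod ((j, p) # (p, i) # A) f = - normal_prod ((j, i) # A) f"
proof -
  have "0 = normal_prod ((j, p) # A) (polar p i f)" using assms by simp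
  also have "\<dots> = (\<Sum>k\<in>L. Var (X j k) * normal_prod A (polar p i (pdiff (X p k) f) + pdiff (X i k) f))"
    by (auto simp: pdiff_polar intro!: sum.cong)
  also have "\<dots> = (\<Sum>k\<in>L. Var (X j k) * normal_prod A (polar p i (pdiff (X p k) f))) + normal_prod ((j, i) # A) f"
    by (simp add: normal_prod_add distrib_left sum.distrib)
  also have "(\<Sum>k\<in>L. Var (X j k) * normal_prod A (polar p i (pdiff (X p k) f))) = normal_prod ((j, p) # (p, i) # A) f"
    by (simp only: normal_prod_polar[OF assms(3)] normal_prod.simps(2)[of j])
  finally show ?thesis by (simp add: eq_neg_iff_add_eq_0)
qed

section \<open>The Capelli operator and its eigenvalues\<close>

definition graph_list :: "(nat \<Rightarrow> nat) \<Rightarrow> nat list \<Rightarrow> (nat \<times> nat) list" where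
  "graph_list s is = map (\<lambda>i. (s i, i)) is"

lemma graph_list_Cons [simp]: "graph_list s (i # is) = (s i, i) # graph_list s is"
  and graph_list_Nil [simp]: "graph_list s [] = []"
  by (simp_all add: graph_list_def)

lemma graph_list_cong: "(\<And>i. i \<in> set is \<Longrightarrow> s i = t i) \<Longrightarrow> graph_list s is = graph_list t is"
  by (simp add: graph_list_def)

lemma snd_graph_list [simp]: "snd ` set (graph_list s is) = set is"
  by (force simp: graph_list_def)

lemma normal_prod_graph_list_mset:
  "mset is = mset js \<Longrightarrow> normal_prod (graph_list s is) f = normal_prod (graph_list s js) f"
  by (rule normal_prod_mset) (simp add: graph_list_def)

text \<open>The normally ordered determinant of the polarisations among rows \<open>p\<close> to
  \<open>N - 1\<close>. Normal ordering takes the place of the diagonal shifts in Capelli's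
  classical determinant; the variable first row \<open>p\<close> permits a recursion.\<close>

definition capelli :: "nat \<Rightarrow> nat \<Rightarrow> 'v cpoly \<Rightarrow> 'v cpoly" where
  "capelli p N f = (\<Sum>s | s permutes {p..<N}. of_int (sign s) * normal_prod (graph_list s [p..<N]) f)"

text \<open>Every permutation is a permutation \<open>q\<close> fixing \<open>p\<close>, followed by
  the transposition of \<open>p\<close> with some \<open>j\<close>. The choice \<open>j = p\<close>
  contributes the eigenvalue \<open>d\<close>. Each of the other \<open>N - 1 - p\<close> choices
  contributes one copy of the smaller operator, since the sign of the transposition cancels the one
  from \<open>normal_prod_transpose\<close>.\<close>

lemma capelli_rec:
  assumes "p < N" and diag: "polar p p f = Const (of_nat d) * f"
    and killed: "\<And>i. p < i \<Longrightarrow> i < N \<Longrightarrow> polar p i f = 0"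
  shows "capelli p N f = Const (of_nat (d + (N - 1 - p))) * capelli (Suc p) N f"
proof -
  let ?S = "{Suc p..<N}"
  let ?F = "\<lambda>s. of_int (sign s) * normal_prod (graph_list s [p..<N]) f"
  let ?G = "\<lambda>s. of_int (sign s) * normal_prod (graph_list s [Suc p..<N]) f"
  have ins: "{p..<N} = insert p ?S" and upt: "[p..<N] = p # [Suc p..<N]"
    using assms(1) by (auto simp: upt_conv_Cons)
  have F_p: "?F (Transposition.transpose p p \<circ> q) = Const (of_nat d) * ?G q" if q: "q permutes ?S" for q
  proof -
    have "q p = p" using q by (simp add: permutes_def)
    then have "normal_prod (graph_list q [p..<N]) f = normal_prod (graph_list q [Suc p..<N]) (polar p p f)"
      using normal_prod_polar[of p "graph_list q [Suc p..<N]" p f] by (simp add: upt)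
    then show ?thesis by (simp add: diag normal_prod_Const_mult mult.left_commute)
  qed
  have F_j: "?F (Transposition.transpose p j \<circ> q) = ?G q" if q: "q permutes ?S" and j: "j \<in> ?S" for q j
  proof -
    define s where "s = Transposition.transpose p j \<circ> q"
    \<comment> \<open>The row \<open>i\<close> that \<open>q\<close> sends to \<open>j\<close> is
      sent to \<open>p\<close> by \<open>s\<close>, which in turn sends \<open>p\<close> to
      \<open>j\<close>. On all other rows \<open>s\<close> and \<open>q\<close> agree, so removing
      the detour through \<open>p\<close> turns the product for \<open>s\<close> into that for
      \<open>q\<close>.\<close>
    have "j \<in> q ` ?S" using permutes_image[OF q] j by simp
    then obtain i where i: "i \<in> ?S" "q i = j" by (elim imageE) simp
    define js where "js = remove1 i [Suc p..<N]"
    have js: "mset [Suc p..<N] = mset (i # js)" using i by (simp add: js_def)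
    then have set_js: "insert i (set js) = ?S" by (metis list.simps(15) set_mset_mset set_upt)
    have "distinct (i # js)" using js mset_eq_imp_distinct_iff[OF js] by simp
    have qp: "q p = p" using q by (simp add: permutes_def)
    have s_eq: "s p = j" "s i = p" using qp i by (simp_all add: s_def)
    have "s x = q x" if "x \<in> set js" for x
    proof -
      have "x \<noteq> i" "x \<in> ?S" using \<open>distinct (i # js)\<close> that set_js by auto
      then have "q x \<noteq> j" "q x \<in> ?S" using i permutes_inj[OF q] permutes_in_image[OF q] by (auto dest: injD)
      then show ?thesis by (auto simp: s_def transpose_def)
    qed
    then have gl: "graph_list s js = graph_list q js" by (rule graph_list_cong)
    have pjs: "p \<notin> set js"
    proof
      assume "p \<in> set js"
      then have "p \<in> insert i (set js)" by simp
      then show False unfolding set_js by simp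
    qed
    have "normal_prod (graph_list s [p..<N]) f = normal_prod (graph_list s (p # i # js)) f"
      using js by (intro normal_prod_graph_list_mset) (simp add: upt)
    also have "\<dots> = - normal_prod (graph_list q (i # js)) f"
      using i killed[of i] pjs by (simp only: graph_list_Cons s_eq gl) (subst normal_prod_transpose; simp)
    also have "normal_prod (graph_list q (i # js)) f = normal_prod (graph_list q [Suc p..<N]) f"
      using js by (intro normal_prod_graph_list_mset) simp
    finally have "normal_prod (graph_list s [p..<N]) f = - normal_prod (graph_list q [Suc p..<N]) f" .
    moreover have "sign s = - sign q"
    proof -
      have "permutation q" using q by (auto simp: permutation_permutes)
      then show ?thesis unfolding s_def using j
        by (subst sign_compose) (auto simp: sign_swap_id permutation_swap_id)
    qed
    ultimately show ?thesis by (simp add: s_def)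
  qed
  have "capelli p N f = (\<Sum>b\<in>insert p ?S. \<Sum>q | q permutes ?S. ?F (Transposition.transpose p b \<circ> q))"
    unfolding capelli_def ins by (rule sum_over_permutations_insert) auto
  also have "\<dots> = (\<Sum>q | q permutes ?S. Const (of_nat d) * ?G q) + (\<Sum>b\<in>?S. \<Sum>q | q permutes ?S. ?G q)"
    using F_p F_j
    by (subst sum.insert) (auto simp del: transpose_same intro!: arg_cong2[where f = "(+)"] sum.cong)
  also have "\<dots> = Const (of_nat d) * capelli (Suc p) N f + of_nat (card ?S) * capelli (Suc p) N f"
    by (simp only: capelli_def sum_distrib_left sum_constant)
  also have "card ?S = N - 1 - p" by simp
  finally show ?thesis
    by (simp only: of_nat_add Const_add Const_of_nat distrib_right)
qed

text \<open>Rows are split off one at a time; for \<open>p = N\<close> only the identity permutation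
  of the empty set remains. The summand \<open>N - 1 - q\<close> counts the rows after
  \<open>q\<close>.\<close>

lemma capelli_eq:
  assumes "p \<le> N"
    and diag: "\<And>q. q < N \<Longrightarrow> polar q q f = Const (of_nat (d q)) * f"
    and killed: "\<And>q i. q < i \<Longrightarrow> i < N \<Longrightarrow> polar q i f = 0"
  shows "capelli p N f = Const (of_nat (\<Prod>q\<in>{p..<N}. d q + (N - 1 - q))) * f"
  using assms(1)
proof (induction p rule: inc_induct)
  case base
  have "{s. s permutes ({} :: nat set)} = {id}" by auto
  then show ?case by (simp add: capelli_def)
next
  case (step p)
  have "{p..<N} = insert p {Suc p..<N}" using step by auto
  then show ?case
    using step capelli_rec[of p N f "d p"] diag killed by (simp add: Const_mult mult.assoc)
qed

section \<open>Expansion into minors and omega operators\<close>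

lemma normal_prod_expand:
  assumes "distinct is"
  shows "normal_prod (graph_list s is) f = (\<Sum>k\<in>Pi\<^sub>E (set is) (\<lambda>_. L).
    (\<Prod>i\<in>set is. Var (X (s i) (k i))) * derivs (map (\<lambda>i. X i (k i)) is) f)"
  using assms
proof (induction "is" arbitrary: f)
  case (Cons i js)
  let ?P = "Pi\<^sub>E (set js) (\<lambda>_. L)"
  have i: "i \<notin> set js" using Cons.prems by simp
  have upd: "(\<Prod>j\<in>set js. Var (X (s j) ((k(i := l)) j))) = (\<Prod>j\<in>set js. Var (X (s j) (k j)))"
    "map (\<lambda>j. X j ((k(i := l)) j)) js = map (\<lambda>j. X j (k j)) js" for k l
    using i by (auto intro!: prod.cong)
  have "normal_prod (graph_list s (i # js)) f = (\<Sum>l\<in>L. \<Sum>k\<in>?P.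
     Var (X (s i) l) * ((\<Prod>j\<in>set js. Var (X (s j) (k j))) * derivs (map (\<lambda>j. X j (k j)) js) (pdiff (X i l) f)))"
    using Cons by (simp add: sum_distrib_left)
  also have "\<dots> = (\<Sum>l\<in>L. \<Sum>k\<in>?P. (\<Prod>j\<in>set (i # js). Var (X (s j) ((k(i := l)) j))) *
      derivs (map (\<lambda>j. X j ((k(i := l)) j)) (i # js)) f)"
    using i by (simp add: upd mult.assoc fun_upd_same del: fun_upd_apply map_eq_conv)
  also have "\<dots> = (\<Sum>k\<in>Pi\<^sub>E (set (i # js)) (\<lambda>_. L). (\<Prod>j\<in>set (i # js). Var (X (s j) (k j))) *
      derivs (map (\<lambda>j. X j (k j)) (i # js)) f)"
    unfolding list.set by (rule sum_PiE_insert[OF i, symmetric])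
  finally show ?case .
qed simp

text \<open>The determinant on the first \<open>N\<close> rows and the columns \<open>k 0\<close> to
  \<open>k (N - 1)\<close>. Columns may be repeated or unordered, so that sums run over all
  functions \<open>k\<close> and can be reindexed by permutations.\<close>

definition minor :: "nat \<Rightarrow> (nat \<Rightarrow> nat) \<Rightarrow> 'v cpoly" where
  "minor N k = (\<Sum>s | s permutes {0..<N}. of_int (sign s) * (\<Prod>i\<in>{0..<N}. Var (X (s i) (k i))))"

text \<open>Cayley's omega operator: the same determinant with partial derivatives in place of the
  variables.\<close>

definition omega :: "nat \<Rightarrow> (nat \<Rightarrow> nat) \<Rightarrow> 'v cpoly \<Rightarrow> 'v cpoly" where
  "omega N k f = (\<Sum>t | t permutes {0..<N}. of_int (sign t) * derivs (map (\<lambda>i. X i (k (t i))) [0..<N]) f)"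

lemma minor_permute:
  assumes t: "t permutes {0..<N}"
  shows "minor N (k \<circ> t) = of_int (sign t) * minor N k"
proof -
  have perm_t: "permutation t" using t by (auto simp: permutation_permutes)
  have "minor N k = (\<Sum>s | s permutes {0..<N}. of_int (sign (s \<circ> inv_into UNIV t)) * (\<Prod>i\<in>{0..<N}. Var (X ((s \<circ> inv_into UNIV t) i) (k i))))"
    unfolding minor_def by (rule sum_permutations_compose_right[OF permutes_inv[OF t]])
  also have "\<dots> = (\<Sum>s | s permutes {0..<N}. of_int (sign t) * (of_int (sign s) * (\<Prod>i\<in>{0..<N}. Var (X (s i) (k (t i))))))"
  proof (intro sum.cong refl)
    fix s assume "s \<in> {s. s permutes {0..<N}}"
    then have "permutation s" by (auto simp: permutation_permutes)
    then have "sign (s \<circ> inv_into UNIV t) = sign t * sign s"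
      using perm_t by (simp add: sign_compose permutation_inverse sign_inverse)
    moreover have "(\<Prod>i\<in>{0..<N}. Var (X ((s \<circ> inv_into UNIV t) i) (k i)) :: 'v cpoly) = (\<Prod>i\<in>{0..<N}. Var (X (s i) (k (t i))))"
      by (subst prod.permute[OF t]) (simp add: o_def permutes_inverses[OF t])
    ultimately show "of_int (sign (s \<circ> inv_into UNIV t)) * (\<Prod>i\<in>{0..<N}. Var (X ((s \<circ> inv_into UNIV t) i) (k i)) :: 'v cpoly)
      = of_int (sign t) * (of_int (sign s) * (\<Prod>i\<in>{0..<N}. Var (X (s i) (k (t i)))))"
      by (simp add: mult.assoc)
  qed
  also have "\<dots> = of_int (sign t) * minor N (k \<circ> t)"
    by (simp add: minor_def sum_distrib_left)
  finally show ?thesis by (simp flip: mult.assoc of_int_mult)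
qed

lemma capelli_expand:
  "capelli 0 N f = (\<Sum>k\<in>Pi\<^sub>E {0..<N} (\<lambda>_. L). minor N k * derivs (map (\<lambda>i. X i (k i)) [0..<N]) f)"
  unfolding capelli_def minor_def
  by (simp add: normal_prod_expand sum_distrib_left sum_distrib_right mult.assoc) (rule sum.swap)

text \<open>Capelli's identity. Permuting the columns changes a minor only by a sign, so summing the
  plain expansion over all permutations of the columns antisymmetrises the derivatives into
  \<open>omega\<close>, at the cost of the factor N!.\<close>

lemma fact_capelli:
  "of_nat (fact N) * capelli 0 N f = (\<Sum>k\<in>Pi\<^sub>E {0..<N} (\<lambda>_. L). minor N k * omega N k f)"
proof -
  let ?P = "Pi\<^sub>E {0..<N} (\<lambda>_. L)" and ?T = "{t. t permutes {0..<N}}"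
  let ?d = "\<lambda>k. derivs (map (\<lambda>i. X i (k i)) [0..<N]) f"
  have perm: "(\<Sum>k\<in>?P. minor N k * ?d k) = (\<Sum>k\<in>?P. minor N (k \<circ> t) * ?d (k \<circ> t))"
    if t: "t permutes {0..<N}" for t
  proof -
    have comp: "k \<circ> s \<in> ?P" if "k \<in> ?P" "s permutes {0..<N}" for k s
      using that permutes_in_image[OF that(2)]
      by (auto simp: PiE_def extensional_def Pi_def permutes_not_in)
    show ?thesis
      by (rule sum.reindex_bij_witness[of _ "\<lambda>k. k \<circ> t" "\<lambda>k. k \<circ> inv_into UNIV t"])
        (use comp t permutes_inv[OF t] in \<open>auto simp: o_assoc[symmetric] permutes_inv_o[OF t]\<close>)
  qed
  have "of_nat (fact N) * capelli 0 N f = (\<Sum>t\<in>?T. capelli 0 N f)"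
    by (simp add: card_permutations)
  also have "\<dots> = (\<Sum>t\<in>?T. \<Sum>k\<in>?P. minor N (k \<circ> t) * ?d (k \<circ> t))"
    unfolding capelli_expand by (rule sum.cong[OF refl], rule perm) simp
  also have "\<dots> = (\<Sum>k\<in>?P. \<Sum>t\<in>?T. minor N k * (of_int (sign t) * ?d (k \<circ> t)))"
    by (subst sum.swap) (simp add: minor_permute mult.assoc mult.left_commute)
  also have "\<dots> = (\<Sum>k\<in>?P. minor N k * omega N k f)"
    by (simp add: omega_def sum_distrib_left)
  finally show ?thesis .
qed

text \<open>\<open>polar p j\<close> multiplies by row \<open>p\<close> only, so derivatives in
  other rows pass through it.\<close>

lemma polar_derivs:
  assumes "\<And>v. v \<in> set vs \<Longrightarrow> \<exists>b k. v = X b k \<and> k \<in> L \<and> b \<noteq> p"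
  shows "polar p j (derivs vs f) = derivs vs (polar p j f)"
  using assms
proof (induction vs arbitrary: f)
  case (Cons v vs)
  obtain b k where "v = X b k" "k \<in> L" "b \<noteq> p" using Cons.prems by force
  then show ?case using Cons by (simp add: pdiff_polar)
qed simp

text \<open>Commuting \<open>polar p j\<close> past \<open>omega\<close> turns the derivative in row
  \<open>p\<close> into minus one in row \<open>j\<close>, while the remaining term vanishes with
  \<open>polar p j f\<close>. What is left is a determinant of derivatives with two equal rows,
  hence zero.\<close>

lemma polar_omega:
  assumes "polar p j f = 0" "p \<noteq> j" "p < N" "j < N" "k \<in> Pi {0..<N} (\<lambda>_. L)"
  shows "polar p j (omega N k f) = 0"
proof -
  let ?T = "{t. t permutes {0..<N}}"
  define js where "js = filter (\<lambda>i. i \<noteq> p \<and> i \<noteq> j) [0..<N]"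
  \<comment> \<open>The summand for \<open>t\<close> after that replacement. Two derivatives are now
    taken in row \<open>j\<close>, so composing \<open>t\<close> with the transposition of
    \<open>p\<close> and \<open>j\<close> does not change it, whereas the sign of \<open>t\<close>
    flips.\<close>
  define G where "G t = derivs (map (\<lambda>i. X i (k (t i))) js)
    (pdiff (X j (k (t j))) (pdiff (X j (k (t p))) f))" for t
  let ?u = "Transposition.transpose p j"
  have mset_is: "mset [0..<N] = mset (p # j # js)"
  proof -
    have "distinct (p # j # js)" "set (p # j # js) = set [0..<N]"
      using assms by (auto simp: js_def)
    then show ?thesis by (metis distinct_upt set_eq_iff_mset_eq_distinct)
  qed
  have kt: "k (t i) \<in> L" if "t \<in> ?T" "i < N" for t i
    using assms(5) permutes_in_image[of t "{0..<N}" i] that by auto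
  have *: "polar p j (derivs (map (\<lambda>i. X i (k (t i))) [0..<N]) f) = - G t" if t: "t \<in> ?T" for t
  proof -
    let ?vs = "map (\<lambda>i. X i (k (t i))) js"
    have "derivs (map (\<lambda>i. X i (k (t i))) [0..<N]) f = derivs (map (\<lambda>i. X i (k (t i))) (p # j # js)) f"
      using mset_is by (intro derivs_mset) (metis mset_map)
    also have "\<dots> = derivs ?vs (pdiff (X j (k (t j))) (pdiff (X p (k (t p))) f))"
      by simp
    also have "polar p j \<dots> = derivs ?vs (polar p j (pdiff (X j (k (t j))) (pdiff (X p (k (t p))) f)))"
      by (rule polar_derivs) (use kt[OF t] in \<open>auto simp: js_def\<close>)
    also have "polar p j (pdiff (X j (k (t j))) (pdiff (X p (k (t p))) f)) =
        pdiff (X j (k (t j))) (polar p j (pdiff (X p (k (t p))) f))"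
      using kt[OF t \<open>j < N\<close>] \<open>p \<noteq> j\<close> by (simp add: pdiff_polar)
    also have "polar p j (pdiff (X p (k (t p))) f) = - pdiff (X j (k (t p))) f"
      using pdiff_polar[OF kt[OF t \<open>p < N\<close>], of p p j f] assms(1) by (simp add: eq_neg_iff_add_eq_0)
    also have "derivs ?vs (pdiff (X j (k (t j))) (- pdiff (X j (k (t p))) f)) = - G t"
      by (simp add: G_def pdiff_uminus derivs_uminus)
    finally show ?thesis .
  qed
  define S where "S = (\<Sum>t\<in>?T. of_int (sign t) * G t)"
  have u: "?u permutes {0..<N}" using assms by (intro permutes_swap_id) auto
  have "S = (\<Sum>t\<in>?T. of_int (sign (t \<circ> ?u)) * G (t \<circ> ?u))"
    unfolding S_def by (rule sum_permutations_compose_right[OF u])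
  also have "\<dots> = (\<Sum>t\<in>?T. - (of_int (sign t) * G t))"
  proof (intro sum.cong refl)
    fix t assume "t \<in> ?T"
    then have "permutation t" by (auto simp: permutation_permutes)
    then have "sign (t \<circ> ?u) = - sign t"
      using \<open>p \<noteq> j\<close> by (simp add: sign_compose permutation_swap_id sign_swap_id)
    moreover have "map (\<lambda>i. X i (k ((t \<circ> ?u) i))) js = map (\<lambda>i. X i (k (t i))) js"
      by (auto simp: js_def transpose_def)
    then have "G (t \<circ> ?u) = G t"
      unfolding G_def by (simp add: pdiff_commute del: map_eq_conv o_apply) (simp add: o_apply pdiff_commute)
    ultimately show "of_int (sign (t \<circ> ?u)) * G (t \<circ> ?u) = - (of_int (sign t) * G t)" by simp
  qed
  finally have "S = - S" by (simp add: S_def sum_negf)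
  then have "coef S m = - coef S m" for m by (metis lookup_uminus)
  then have "S = 0" by (intro poly_mapping_eqI) (simp add: eq_neg_iff_add_eq_0)
  moreover have "polar p j (omega N k f) = - S"
  proof -
    have oi: "of_int z = (Const (of_int z) :: 'v cpoly)" for z
      by (cases z) (simp_all add: Const_of_nat Const_uminus Const_diff)
    show ?thesis unfolding omega_def polar_sum S_def oi polar_Const_mult
      by (simp add: * sum_negf)
  qed
  ultimately show ?thesis by simp
qed

end

section \<open>Invariants of the unipotent group\<close>

lemma coef_sum_sing: "finite K \<Longrightarrow> coef (\<Sum>m\<in>K. sing m (g m)) k = (if k \<in> K then g k else 0)"
  by (simp add: lookup_sum lookup_single when_def)

text \<open>Apart from homogeneous components, this also collects the monomials that belong to one
  power of f_1'.\<close>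

definition restrict_supp :: "('k \<Rightarrow> bool) \<Rightarrow> ('k \<Rightarrow>\<^sub>0 'b::comm_monoid_add) \<Rightarrow> 'k \<Rightarrow>\<^sub>0 'b" where
  "restrict_supp R P = (\<Sum>m\<in>{m \<in> supp P. R m}. sing m (coef P m))"

lemma coef_restrict_supp: "coef (restrict_supp R P) m = (if R m then coef P m else 0)"
  by (simp add: restrict_supp_def coef_sum_sing in_keys_iff)

lemma supp_restrict_supp: "supp (restrict_supp R P) = {m \<in> supp P. R m}"
  by (auto simp: in_keys_iff coef_restrict_supp split: if_splits)

lemma sum_restrict_supp:
  "(\<Sum>d\<in>g ` supp P. restrict_supp (\<lambda>m. g m = d) P) = P"
proof (intro poly_mapping_eqI)
  fix m
  have "coef (\<Sum>d\<in>g ` supp P. restrict_supp (\<lambda>m. g m = d) P) m =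
    (\<Sum>d\<in>g ` supp P. if g m = d then coef P m else 0)"
    by (simp add: lookup_sum coef_restrict_supp)
  then show "coef (\<Sum>d\<in>g ` supp P. restrict_supp (\<lambda>m. g m = d) P) m = coef P m"
    by (auto simp: sum.delta in_keys_iff)
qed

section \<open>Bounds for weighted degrees\<close>

definition wdeg_le :: "('v \<Rightarrow> nat) \<Rightarrow> nat \<Rightarrow> 'v cpoly \<Rightarrow> bool" where
  "wdeg_le w d P \<longleftrightarrow> (\<forall>m\<in>supp P. wdeg w m \<le> d)"

lemma wdeg_le_add: "wdeg_le w d P \<Longrightarrow> wdeg_le w d Q \<Longrightarrow> wdeg_le w d (P + Q)"
  unfolding wdeg_le_def using Poly_Mapping.keys_add[of P Q] by blast

lemma wdeg_le_0 [simp]: "wdeg_le w d 0"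
  by (simp add: wdeg_le_def)

lemma wdeg_le_sum: "(\<And>a. a \<in> A \<Longrightarrow> wdeg_le w d (F a)) \<Longrightarrow> wdeg_le w d (sum F A)"
  by (induction A rule: infinite_finite_induct) (auto intro: wdeg_le_add)

lemma wdeg_le_mult:
  assumes "wdeg_le w d P" "wdeg_le w e Q"
  shows "wdeg_le w (d + e) (P * Q)"
  unfolding wdeg_le_def
proof
  fix m assume "m \<in> supp (P * Q)"
  then obtain a b where "m = a + b" "a \<in> supp P" "b \<in> supp Q"
    using keys_mult[of P Q] by blast
  then show "wdeg w m \<le> d + e"
    using assms by (auto simp: wdeg_le_def wdeg_add intro: add_mono)
qed

lemma wdeg_le_Const [simp]: "wdeg_le w d (Const c)"
  by (auto simp: wdeg_le_def Const_def split: if_splits)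

lemma wdeg_le_Var: "w v \<le> d \<Longrightarrow> wdeg_le w d (Var v)"
  by (simp add: wdeg_le_def Var_def)

lemma cpoly_vars_empty: "vars P = {} \<Longrightarrow> P = Const (coef P 0)"
proof (intro poly_mapping_eqI)
  fix m assume "vars P = {}"
  then have "m \<in> supp P \<Longrightarrow> m = 0" by (auto simp: vars_def)
  then show "coef P m = coef (Const (coef P 0)) m"
    by (auto simp: Const_def lookup_single when_def in_keys_iff)
qed

context var_matrix
begin

section \<open>Components homogeneous in each row\<close>

definition row_deg :: "('v \<Rightarrow>\<^sub>0 nat) \<Rightarrow> nat \<Rightarrow> nat" where
  "row_deg m i = (\<Sum>l\<in>L. coef m (X i l))"

lemma row_deg_add: "row_deg (m + m') i = row_deg m i + row_deg m' i"
  by (simp add: row_deg_def lookup_add sum.distrib)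

lemma row_deg_sing: "l \<in> L \<Longrightarrow> row_deg (sing (X j l) 1) i = (if i = j then 1 else 0)"
  by (auto simp: row_deg_def lookup_single when_def)

text \<open>\<open>polar p i\<close> moves one degree from row \<open>i\<close> to row
  \<open>p\<close>, so the images of components with different row degrees share no monomials and
  cannot cancel.\<close>

lemma polar_row_component:
  assumes "polar p i f = 0"
  shows "polar p i (restrict_supp (\<lambda>m. row_deg m = d) f) = 0"
proof (intro poly_mapping_eqI)
  fix m :: "'v \<Rightarrow>\<^sub>0 nat"
  \<comment> \<open>The row degree of monomials in the image of the component \<open>d\<close>: one
    more in row \<open>p\<close> and one less in row \<open>i\<close>, written without
    subtraction.\<close>
  define R where "R \<longleftrightarrow> (\<forall>q. row_deg m q + (if q = i then 1 else 0) = d q + (if q = p then 1 else 0))"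
  have coef_polar: "coef (polar p i g) m = (\<Sum>l\<in>L. if coef m (X p l) = 0 then 0 else
    of_nat (Suc (coef (m - sing (X p l) 1) (X i l))) * coef g (m - sing (X p l) 1 + sing (X i l) 1))" for g
    by (simp add: polar_def lookup_sum coef_Var_mult coef_pdiff cong: if_cong)
  have *: "row_deg (m - sing (X p l) 1 + sing (X i l) 1) = d \<longleftrightarrow> R" if "l \<in> L" "coef m (X p l) \<noteq> 0" for l
  proof -
    define m0 where "m0 = m - sing (X p l) 1"
    have m: "m = m0 + sing (X p l) 1" unfolding m0_def using that(2)
      by (intro poly_mapping_eqI) (auto simp: lookup_add lookup_minus lookup_single when_def)
    have "row_deg (m0 + sing (X i l) 1) = d \<longleftrightarrow> (\<forall>q. row_deg m0 q + (if q = i then 1 else 0) = d q)"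
      by (simp only: fun_eq_iff row_deg_add row_deg_sing[OF that(1)])
    also have "\<dots> \<longleftrightarrow> R"
      unfolding R_def m row_deg_add row_deg_sing[OF that(1)] by (intro iff_allI) arith
    finally show ?thesis by (simp add: m0_def)
  qed
  have "coef (polar p i (restrict_supp (\<lambda>m. row_deg m = d) f)) m = (if R then coef (polar p i f) m else 0)"
    unfolding coef_polar coef_restrict_supp
    by (cases R) (auto simp: * simp del: One_nat_def cong: if_cong intro!: sum.cong sum.neutral)
  then show "coef (polar p i (restrict_supp (\<lambda>m. row_deg m = d) f)) m = coef 0 m"
    using assms by simp
qed

text \<open>On the diagonal, the polarisation is the Euler operator of row \<open>p\<close>.\<close>

lemma polar_diag_row_component:
  "polar p p (restrict_supp (\<lambda>m. row_deg m = d) f) =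
   Const (of_nat (d p)) * restrict_supp (\<lambda>m. row_deg m = d) f"
proof (intro poly_mapping_eqI)
  fix m
  have "coef (polar p p (restrict_supp (\<lambda>m. row_deg m = d) f)) m =
    of_nat (row_deg m p) * coef (restrict_supp (\<lambda>m. row_deg m = d) f) m"
    by (simp add: polar_def lookup_sum coef_Euler row_deg_def sum_distrib_right)
  then show "coef (polar p p (restrict_supp (\<lambda>m. row_deg m = d) f)) m =
    coef (Const (of_nat (d p)) * restrict_supp (\<lambda>m. row_deg m = d) f) m"
    by (auto simp: coef_Const_mult coef_restrict_supp)
qed

section \<open>Polynomials in the minors, with a weight bound\<close>

definition indices :: "nat \<Rightarrow> (nat \<times> (nat \<Rightarrow> nat)) set" where
  "indices N = (SIGMA n:{2..N + 1}. {2..n} \<rightarrow>\<^sub>E L)"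

text \<open>A first entry \<open>n\<close> stands for a minor of size \<open>n - 1\<close> whose
  columns are numbered from 2, in agreement with \<open>Lam_minor\<close>.\<close>

definition indexed_minor :: "nat \<times> (nat \<Rightarrow> nat) \<Rightarrow> 'v cpoly" where
  "indexed_minor = (\<lambda>(n, ls). minor (n - 1) (\<lambda>i. ls (i + 2)))"

text \<open>Every term of a minor takes one variable from each of its columns, so this is the weight
  of the minor when \<open>X i l\<close> has weight \<open>l\<close>.\<close>

definition index_weight :: "nat \<times> (nat \<Rightarrow> nat) \<Rightarrow> nat" where
  "index_weight = (\<lambda>(n, ls). \<Sum>j\<in>{2..n}. ls j)"

text \<open>The weight bound is imposed on \<open>T\<close> rather than on \<open>f\<close>: because
  of the relations between minors, \<open>T\<close> could otherwise contain heavier terms that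
  cancel after substitution.\<close>

definition minor_poly :: "nat \<Rightarrow> nat \<Rightarrow> 'v cpoly \<Rightarrow> bool" where
  "minor_poly N d f \<longleftrightarrow> (\<exists>T. vars T \<subseteq> indices N \<and> wdeg_le index_weight d T \<and> f = subst indexed_minor T)"

lemma minor_poly_Const: "minor_poly N d (Const c)"
  unfolding minor_poly_def by (intro exI[of _ "Const c"]) simp

lemma minor_poly_sum:
  assumes "\<And>a. a \<in> A \<Longrightarrow> minor_poly N d (F a)"
  shows "minor_poly N d (sum F A)"
proof -
  have "\<forall>a\<in>A. \<exists>T. vars T \<subseteq> indices N \<and> wdeg_le index_weight d T \<and> F a = subst indexed_minor T"
    using assms by (auto simp: minor_poly_def)
  then obtain T where T: "\<forall>a\<in>A. vars (T a) \<subseteq> indices N \<and> wdeg_le index_weight d (T a) \<and> F a = subst indexed_minor (T a)"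
    by metis
  have "vars (sum T A) \<subseteq> indices N" using vars_sum[of T A] T by fastforce
  moreover have "wdeg_le index_weight d (sum T A)" using T by (intro wdeg_le_sum) auto
  moreover have "sum F A = subst indexed_minor (sum T A)" using T by simp
  ultimately show ?thesis unfolding minor_poly_def by blast
qed

lemma minor_poly_mult:
  assumes "minor_poly N d f" "minor_poly N e g"
  shows "minor_poly N (d + e) (f * g)"
proof -
  obtain S T where "vars S \<subseteq> indices N" "wdeg_le index_weight d S" "f = subst indexed_minor S"
    "vars T \<subseteq> indices N" "wdeg_le index_weight e T" "g = subst indexed_minor T"
    using assms by (auto simp: minor_poly_def)
  then show ?thesis
    unfolding minor_poly_def using vars_mult[of S T]
    by (intro exI[of _ "S * T"]) (auto intro: wdeg_le_mult)
qed

lemma minor_poly_minor: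
  assumes "N > 0" "k \<in> {0..<N} \<rightarrow>\<^sub>E L"
  shows "minor_poly N (\<Sum>i<N. k i) (minor N k)"
proof -
  define ls where "ls = restrict (\<lambda>j. k (j - 2)) {2..N + 1}"
  have ls: "ls (i + 2) = k i" if "i < N" for i using that by (simp add: ls_def)
  have "(\<Sum>j\<in>{2..N + 1}. ls j) = (\<Sum>i<N. k i)"
    by (rule sum.reindex_bij_witness[of _ "\<lambda>i. i + 2" "\<lambda>j. j - 2"]) (auto simp: ls_def)
  moreover have "ls \<in> {2..N + 1} \<rightarrow>\<^sub>E L" using PiE_mem[OF assms(2)] by (auto simp: ls_def)
  moreover have "indexed_minor (N + 1, ls) = minor N k"
    unfolding indexed_minor_def minor_def using ls by (auto intro!: sum.cong arg_cong2[where f = "(*)"] prod.cong)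
  ultimately show ?thesis
    unfolding minor_poly_def using assms(1)
    by (intro exI[of _ "Var (N + 1, ls)"]) (auto simp: indices_def index_weight_def intro!: wdeg_le_Var)
qed

lemma minor_poly_mono: "minor_poly N d f \<Longrightarrow> N \<le> N' \<Longrightarrow> d \<le> d' \<Longrightarrow> minor_poly N' d' f"
  unfolding minor_poly_def indices_def wdeg_le_def
  by (elim exE conjE) (rule exI, force)

text \<open>Capelli's method: a row-homogeneous invariant is a non-zero multiple of
  \<open>\<Sum>\<^sub>k minor N k * omega N k f\<close>, and the \<open>omega N k f\<close> are again invariant, of lower degree.\<close>

theorem unipotent_first_fundamental:
  assumes "vars f \<subseteq> {X i l | i l. i < N \<and> l \<in> L}" and "0 \<notin> L"
    and "\<And>i l. w (X i l) = l" and "wdeg_le w d f"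
    and "\<And>p i. p < i \<Longrightarrow> i < N \<Longrightarrow> polar p i f = 0"
  shows "minor_poly N d f"
  using assms(1,4,5)
\<comment> \<open>Each descent lowers either the number of rows \<open>N\<close> or the weight bound
  \<open>d\<close> and keeps the other.\<close>
proof (induction "d + N" arbitrary: d N f rule: less_induct)
  case less
  show ?case
  proof (cases N)
    case 0
    then have "vars f = {}" using less.prems(1) by auto
    then show ?thesis using cpoly_vars_empty minor_poly_Const by metis
  next
    case (Suc M)
    let ?c = "\<lambda>e. restrict_supp (\<lambda>m. row_deg m = e) f"
    have "minor_poly N d (?c e)" for e
    proof -
      let ?g = "?c e"
      have g_vars: "vars ?g \<subseteq> vars f" by (auto simp: vars_def supp_restrict_supp)
      have g_wdeg: "wdeg_le w d ?g" using less.prems(2) by (auto simp: wdeg_le_def supp_restrict_supp)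
      have g_polar: "polar p i ?g = 0" if "p < i" "i < N" for p i
        using less.prems(3)[OF that] by (rule polar_row_component)
      show ?thesis
      proof (cases "e M = 0")
        \<comment> \<open>A missing last row is dropped. Capelli's identity would give nothing here,
          since the factor of its eigenvalue for \<open>q = M\<close> is \<open>e M\<close>.\<close>
        case True
        have "vars ?g \<subseteq> {X i l | i l. i < M \<and> l \<in> L}"
        proof
          fix v assume v: "v \<in> vars ?g"
          then obtain i l where il: "v = X i l" "i < N" "l \<in> L" using g_vars less.prems(1) by blast
          obtain m where m: "m \<in> supp ?g" "v \<in> supp m" using v by (auto simp: vars_def)
          then have "row_deg m M = 0" using True by (auto simp: supp_restrict_supp)
          then have "coef m (X M l) = 0" using il(3) by (simp add: row_deg_def)
          then have "i \<noteq> M" using m(2) il(1) by (auto simp: in_keys_iff)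
          then show "v \<in> {X i l | i l. i < M \<and> l \<in> L}" using il Suc by auto
        qed
        then have "minor_poly M d ?g"
          using g_wdeg g_polar Suc by (intro less.hyps) auto
        then show ?thesis by (rule minor_poly_mono) (use Suc in auto)
      next
        case False
        \<comment> \<open>The eigenvalue of the Capelli operator times the N! from antisymmetrising.
          The factors for \<open>q < M\<close> are positive because of \<open>N - 1 - q\<close>, the
          one for \<open>q = M\<close> because of \<open>e M\<close>.\<close>
        define c :: nat where "c = fact N * (\<Prod>q\<in>{0..<N}. e q + (N - 1 - q))"
        have "e q + (N - 1 - q) \<noteq> 0" if "q < N" for q
          using that False Suc by (cases "q = M") auto
        then have "c \<noteq> 0" by (auto simp: c_def)
        have "of_nat (fact N) * capelli 0 N ?g = Const (of_nat c) * ?g"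
          using capelli_eq[of 0 N ?g e] polar_diag_row_component g_polar
          by (simp add: c_def Const_mult Const_of_nat mult.assoc del: of_nat_fact)
        then have c_g: "Const (of_nat c) * ?g = (\<Sum>k\<in>{0..<N} \<rightarrow>\<^sub>E L. minor N k * omega N k ?g)"
          by (simp only: fact_capelli)
        have "minor_poly N d (minor N k * omega N k ?g)" if k: "k \<in> {0..<N} \<rightarrow>\<^sub>E L" for k
        proof -
          let ?s = "\<Sum>i<N. k i"
          \<comment> \<open>Here \<open>0 \<notin> L\<close> enters: columns have positive weight,
            so \<open>omega\<close> strictly lowers the weight bound.\<close>
          have "k 0 \<noteq> 0" using k Suc \<open>0 \<notin> L\<close> by (metis PiE_mem atLeastLessThan_iff zero_le zero_less_Suc)
          moreover have "k 0 \<le> ?s" using Suc by (intro member_le_sum) auto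
          ultimately have "?s > 0" by simp
          have wdeg_omega: "wdeg w m + ?s \<in> wdeg w ` supp ?g" if "m \<in> supp (omega N k ?g)" for m
          proof -
            have "supp (omega N k ?g) \<subseteq> (\<Union>t\<in>{t. t permutes {0..<N}}.
              supp (of_int (sign t) * derivs (map (\<lambda>i. X i (k (t i))) [0..<N]) ?g))"
              unfolding omega_def by (rule order.trans[OF Poly_Mapping.keys_sum]) simp
            from subsetD[OF this that] obtain t where t: "t permutes {0..<N}"
              "m \<in> supp (of_int (sign t) * derivs (map (\<lambda>i. X i (k (t i))) [0..<N]) ?g)"
              by (elim UN_E) simp
            then have "m \<in> supp (derivs (map (\<lambda>i. X i (k (t i))) [0..<N]) ?g)"
              by (cases t rule: sign_cases) (auto simp: in_keys_iff)
            from supp_derivs[OF this, of w] have "wdeg w m + (\<Sum>i<N. k (t i)) \<in> wdeg w ` supp ?g"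
              using assms(3) by (simp add: comp_def interv_sum_list_conv_sum_set_nat atLeast0LessThan)
            also have "(\<Sum>i<N. k (t i)) = ?s"
              using sum.permute[OF t(1), of k] by (simp add: comp_def atLeast0LessThan)
            finally show ?thesis .
          qed
          show ?thesis
          proof (cases "?s \<le> d")
            case True
            have "vars (omega N k ?g) \<subseteq> vars ?g"
            proof -
              have "vars (of_int (sign t) * derivs vs ?g) \<subseteq> vars ?g" for t :: "nat \<Rightarrow> nat" and vs
                using vars_derivs[of vs ?g] by (cases t rule: sign_cases) auto
              then show ?thesis unfolding omega_def by (intro order.trans[OF vars_sum]) blast
            qed
            moreover have "wdeg_le w (d - ?s) (omega N k ?g)"
              unfolding wdeg_le_def
            proof
              fix m assume "m \<in> supp (omega N k ?g)"
              then have "wdeg w m + ?s \<le> d" using wdeg_omega g_wdeg by (fastforce simp: wdeg_le_def)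
              then show "wdeg w m \<le> d - ?s" by simp
            qed
            moreover have "polar p i (omega N k ?g) = 0" if "p < i" "i < N" for p i
              using g_polar that k by (intro polar_omega) (auto simp: PiE_def)
            ultimately have "minor_poly N (d - ?s) (omega N k ?g)"
              using \<open>?s > 0\<close> True g_vars less.prems(1) by (intro less.hyps) auto
            then have "minor_poly N (?s + (d - ?s)) (minor N k * omega N k ?g)"
              using k Suc by (intro minor_poly_mult minor_poly_minor) auto
            then show ?thesis using True by simp
          next
            case False
            \<comment> \<open>\<open>omega\<close> lowers weights by \<open>?s\<close>, which is
              more than any monomial of the component has.\<close>
            have "supp (omega N k ?g) = {}"
            proof (rule ccontr)
              assume "supp (omega N k ?g) \<noteq> {}"
              then obtain m where "m \<in> supp (omega N k ?g)" by blast
              then have "wdeg w m + ?s \<le> d" using wdeg_omega g_wdeg by (fastforce simp: wdeg_le_def)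
              then show False using False by simp
            qed
            then have "omega N k ?g = 0" by simp
            then show ?thesis using minor_poly_Const[of N d 0] by simp
          qed
        qed
        then have "minor_poly N d (Const (of_nat c) * ?g)"
          unfolding c_g by (rule minor_poly_sum)
        then have "minor_poly N (0 + d) (Const (1 / of_nat c) * (Const (of_nat c) * ?g))"
          by (intro minor_poly_mult minor_poly_Const)
        moreover have "Const (1 / of_nat c) * (Const (of_nat c) * ?g) = ?g"
          using \<open>c \<noteq> 0\<close> by (simp flip: mult.assoc Const_mult)
        ultimately show ?thesis by simp
      qed
    qed
    then have "minor_poly N d (\<Sum>e\<in>row_deg ` supp f. ?c e)" by (intro minor_poly_sum)
    then show ?thesis by (simp only: sum_restrict_supp)
  qed
qed

end

section \<open>Invariant jet polynomials\<close>

lemma vars_prod: "vars (prod F A) \<subseteq> (\<Union>a\<in>A. vars (F a))"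
proof (induction A rule: infinite_finite_induct)
  case (insert a A)
  then show ?case using vars_mult[of "F a" "prod F A"] by auto
qed (simp_all flip: Const_1)

lemma vars_power: "vars (P ^ k) \<subseteq> vars P"
proof (induction k)
  case (Suc k)
  then show ?case using vars_mult[of P "P ^ k"] by auto
qed (simp flip: Const_1)

lemma vars_subst: "vars (subst s P) \<subseteq> (\<Union>v\<in>vars P. vars (s v))"
proof -
  have "vars (Const (coef P m) * mono_value s m) \<subseteq> (\<Union>v\<in>vars P. vars (s v))" if "m \<in> supp P" for m
  proof -
    have "vars (mono_value s m) \<subseteq> (\<Union>v\<in>supp m. vars (s v))"
      unfolding mono_value_def using vars_prod[of "\<lambda>v. s v ^ coef m v" "supp m"] vars_power by fastforce
    also have "\<dots> \<subseteq> (\<Union>v\<in>vars P. vars (s v))" using that by (auto simp: vars_def)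
    finally show ?thesis using vars_mult[of "Const (coef P m)" "mono_value s m"] by auto
  qed
  then show ?thesis
    unfolding subst_eq_sum by (intro order.trans[OF vars_sum] UN_least)
qed

lemma wdeg_le_1 [simp]: "wdeg_le w d 1"
  using wdeg_le_Const[of w d 1] by simp

lemma wdeg_le_power: "wdeg_le w d P \<Longrightarrow> wdeg_le w (k * d) (P ^ k)"
  by (induction k) (auto intro: wdeg_le_mult)

lemma wdeg_le_prod:
  "(\<And>a. a \<in> A \<Longrightarrow> wdeg_le w (d a) (F a)) \<Longrightarrow> wdeg_le w (sum d A) (prod F A)"
  by (induction A rule: infinite_finite_induct) (auto intro: wdeg_le_mult)

lemma wdeg_le_mono: "wdeg_le w d P \<Longrightarrow> d \<le> e \<Longrightarrow> wdeg_le w e P"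
  by (fastforce simp: wdeg_le_def)

lemma wdeg_le_subst:
  assumes "\<And>v. wdeg_le w' (w v) (s v)" "wdeg_le w d P"
  shows "wdeg_le w' d (subst s P)"
  unfolding subst_eq_sum
proof (rule wdeg_le_sum)
  fix m assume m: "m \<in> supp P"
  have "wdeg_le w' (wdeg w m) (mono_value s m)"
    unfolding mono_value_def wdeg_def by (intro wdeg_le_prod wdeg_le_power assms)
  then have "wdeg_le w' (0 + wdeg w m) (Const (coef P m) * mono_value s m)"
    by (intro wdeg_le_mult) auto
  then show "wdeg_le w' d (Const (coef P m) * mono_value s m)"
    by (rule wdeg_le_mono) (use assms(2) m in \<open>auto simp: wdeg_le_def\<close>)
qed

section \<open>The total derivative and the bracket with f_1'\<close>

lemma vars_D: "vars (D P) \<subseteq> vars P \<union> (\<lambda>v. Jet (component v) (Suc (jet_order v))) ` vars P"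
  unfolding D_def
proof (intro order.trans[OF vars_sum] UN_least)
  fix v assume "v \<in> vars P"
  then show "vars (Var (Jet (component v) (Suc (jet_order v))) * pdiff v P) \<subseteq>
      vars P \<union> (\<lambda>v. Jet (component v) (Suc (jet_order v))) ` vars P"
    using vars_mult[of "Var (Jet (component v) (Suc (jet_order v)))" "pdiff v P"] vars_pdiff[of v P] by auto
qed

lemma D_Var [simp]: "D (Var v) = Var (Jet (component v) (Suc (jet_order v)))"
  by (simp add: D_def)

text \<open>This is the numerator that the quotient rule produces for P / f_1'^p after common powers
  of f_1' are cancelled.\<close>

lemma eval_at_bracket:
  "eval_at x (bracket p 1 P (Var (Jet 1 1))) =
    eval_at x (D P) * x (Jet 1 1) - of_nat p * eval_at x P * x (Jet 1 2)"
  by (simp add: bracket_def numeral_2_eq_2)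

lemma vars_bracket:
  "vars (bracket p 1 P (Var (Jet 1 1))) \<subseteq>
    vars P \<union> (\<lambda>v. Jet (component v) (Suc (jet_order v))) ` vars P \<union> {Jet 1 1, Jet 1 2}"
proof -
  have "vars (of_nat p * P * Var (Jet 1 2)) \<subseteq> vars P \<union> {Jet 1 2}"
    using vars_mult[of "of_nat p * P" "Var (Jet 1 2)"] vars_mult[of "of_nat p" P] by auto
  moreover have "vars (D P * Var (Jet 1 1)) \<subseteq> vars (D P) \<union> {Jet 1 1}"
    using vars_mult[of "D P" "Var (Jet 1 1)"] by auto
  moreover have "bracket p 1 P (Var (Jet 1 1)) = D P * Var (Jet 1 1) - of_nat p * P * Var (Jet 1 2)"
    by (simp add: bracket_def numeral_2_eq_2)
  ultimately show ?thesis
    using vars_diff[of "D P * Var (Jet 1 1)" "of_nat p * P * Var (Jet 1 2)"] vars_D[of P] by auto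
qed

lemma Lam_2: "Lam i 2 = bracket 1 1 (Var (Jet i 1)) (Var (Jet 1 1))"
  by (simp add: numeral_2_eq_2)

lemma Lam_Suc: "2 \<le> l \<Longrightarrow> Lam i (Suc l) = bracket (2 * l - 1) 1 (Lam i l) (Var (Jet 1 1))"
  by (cases l; cases "l - 1") (auto simp: numeral_2_eq_2)

text \<open>The order bound ensures that a curve with prescribed jet up to order \<kappa> determines
  the value of \<open>Lam i l\<close> whenever l \<le> \<kappa>.\<close>

lemma vars_Lam: "2 \<le> l \<Longrightarrow> vars (Lam i l) \<subseteq> {Jet j k | j k. j \<in> {1, i} \<and> 1 \<le> k \<and> k \<le> l}"
proof (induction l rule: nat_induct_at_least)
  case base
  have "{Jet i 1} \<union> {Jet i 2} \<union> {Jet 1 1, Jet 1 2} \<subseteq> {Jet j k | j k. j \<in> {1, i} \<and> 1 \<le> k \<and> k \<le> 2}"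
    by auto
  moreover have "vars (Lam i 2) \<subseteq> {Jet i 1} \<union> {Jet i 2} \<union> {Jet 1 1, Jet 1 2}"
    unfolding Lam_2 using vars_bracket[of 1 "Var (Jet i 1)"] by (simp add: numeral_2_eq_2)
  ultimately show ?case by (rule order.trans[rotated])
next
  case (Suc l)
  have "vars (Lam i (Suc l)) \<subseteq>
    vars (Lam i l) \<union> (\<lambda>v. Jet (component v) (Suc (jet_order v))) ` vars (Lam i l) \<union> {Jet 1 1, Jet 1 2}"
    unfolding Lam_Suc[OF Suc.hyps] by (rule vars_bracket)
  also have "\<dots> \<subseteq> {Jet j k | j k. j \<in> {1, i} \<and> 1 \<le> k \<and> k \<le> Suc l}"
  proof (intro Un_least)
    show "vars (Lam i l) \<subseteq> {Jet j k | j k. j \<in> {1, i} \<and> 1 \<le> k \<and> k \<le> Suc l}"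
      by (rule order.trans[OF Suc.IH]) auto
    show "(\<lambda>v. Jet (component v) (Suc (jet_order v))) ` vars (Lam i l) \<subseteq>
      {Jet j k | j k. j \<in> {1, i} \<and> 1 \<le> k \<and> k \<le> Suc l}"
      by (rule order.trans[OF image_mono[OF Suc.IH]]) auto
  qed (use Suc.hyps in auto)
  finally show ?case .
qed

text \<open>Differentiating a jet coordinate gives the next one, so the chain rule yields exactly
  the sum that defines \<open>D\<close>. Entire curves spare any care for domains.\<close>

lemma has_field_derivative_jet:
  assumes "\<And>i. f i holomorphic_on UNIV"
  shows "((\<lambda>z. eval_at (jet f z) P) has_field_derivative eval_at (jet f z) (D P)) (at z)"
proof -
  have "((\<lambda>z. eval_at (jet f z) P) has_field_derivative
    (\<Sum>v\<in>vars P. jet f z (Jet (component v) (Suc (jet_order v))) * eval_at (jet f z) (pdiff v P))) (at z)"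
  proof (rule has_field_derivative_eval_at)
    fix v
    show "((\<lambda>z. jet f z v) has_field_derivative jet f z (Jet (component v) (Suc (jet_order v)))) (at z)"
      using has_field_derivative_higher_deriv[OF assms open_UNIV, of z "jet_order v" "component v"]
      unfolding jet_def by simp
  qed auto
  then show ?thesis by (simp add: D_def)
qed

text \<open>In the coordinate w = f_1(z), differentiation is (1/f_1') d/dz. It takes P / f_1'^p to
  [P, f_1'] / f_1'^(p+2), which is the recursion defining \<open>Lam\<close>, started at f_i' / f_1'
  with p = 1.\<close>

lemma higher_deriv_comp_inverse:
  assumes f: "\<And>i. f i holomorphic_on UNIV" and U: "open U" and phi: "\<phi> holomorphic_on U"
    and inverse: "\<And>w. w \<in> U \<Longrightarrow> f 1 (\<phi> w) = w" and w: "w \<in> U"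
  shows "jet f (\<phi> w) (Jet 1 1) \<noteq> 0"
    and "deriv \<phi> w = 1 / jet f (\<phi> w) (Jet 1 1)"
    and "deriv (f i \<circ> \<phi>) w = jet f (\<phi> w) (Jet i 1) / jet f (\<phi> w) (Jet 1 1)"
    and "2 \<le> l \<Longrightarrow> (deriv ^^ l) (f i \<circ> \<phi>) w =
      eval_at (jet f (\<phi> w)) (Lam i l) / jet f (\<phi> w) (Jet 1 1) ^ (2 * l - 1)"
proof -
  let ?J = "\<lambda>w. jet f (\<phi> w) (Jet 1 1)"
  have dphi: "(\<phi> has_field_derivative deriv \<phi> w) (at w)" if "w \<in> U" for w
    using phi U that by (rule holomorphic_derivI)
  have df: "(f i has_field_derivative jet f z (Jet i 1)) (at z)" for i z
    using holomorphic_derivI[OF f open_UNIV] by (simp add: jet_def)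
  have J1: "?J w * deriv \<phi> w = 1" if "w \<in> U" for w
  proof -
    have "((\<lambda>w. f 1 (\<phi> w)) has_field_derivative ?J w * deriv \<phi> w) (at w)"
      using DERIV_chain2[OF df dphi[OF that]] .
    then have "((\<lambda>w. w) has_field_derivative ?J w * deriv \<phi> w) (at w)"
      by (rule has_field_derivative_transform_within_open[OF _ U that]) (rule inverse)
    then show ?thesis using DERIV_ident DERIV_unique by blast
  qed
  have J: "?J w \<noteq> 0" if "w \<in> U" for w
    using J1[OF that] by auto
  have dphi_eq: "deriv \<phi> w = 1 / ?J w" if "w \<in> U" for w
    using J1[OF that] J[OF that] by (simp add: field_simps)
  show "?J w \<noteq> 0" "deriv \<phi> w = 1 / ?J w" using J dphi_eq w by auto
  have d1: "deriv (f i \<circ> \<phi>) w = jet f (\<phi> w) (Jet i 1) / ?J w" if "w \<in> U" for w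
    using DERIV_chain[OF df dphi[OF that], THEN DERIV_imp_deriv] dphi_eq[OF that] by simp
  then show "deriv (f i \<circ> \<phi>) w = jet f (\<phi> w) (Jet i 1) / ?J w" using w .
  \<comment> \<open>The pole order grows by 2: one from the quotient rule, one from the derivative
    1/f_1' of \<phi>.\<close>
  have step: "deriv g w = eval_at (jet f (\<phi> w)) (bracket p 1 P (Var (Jet 1 1))) / ?J w ^ (p + 2)"
    if g: "\<And>w. w \<in> U \<Longrightarrow> g w = eval_at (jet f (\<phi> w)) P / ?J w ^ p" and w: "w \<in> U" and p: "p > 0" for g p P w
  proof -
    have dP: "((\<lambda>w. eval_at (jet f (\<phi> w)) P) has_field_derivative eval_at (jet f (\<phi> w)) (D P) * deriv \<phi> w) (at w)" for P
      by (rule DERIV_chain2[OF has_field_derivative_jet[OF f] dphi[OF w]])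
    have dJ: "(?J has_field_derivative jet f (\<phi> w) (Jet 1 2) * deriv \<phi> w) (at w)"
      using dP[of "Var (Jet 1 1)"] by (simp add: numeral_2_eq_2)
    have dJp: "((\<lambda>w. ?J w ^ p) has_field_derivative
      of_nat p * (jet f (\<phi> w) (Jet 1 2) * deriv \<phi> w) * ?J w ^ (p - Suc 0)) (at w)"
      using DERIV_power[OF dJ, of p] by (simp add: mult.assoc)
    have "((\<lambda>w. eval_at (jet f (\<phi> w)) P / ?J w ^ p) has_field_derivative
      (eval_at (jet f (\<phi> w)) (D P) * deriv \<phi> w * ?J w ^ p -
       eval_at (jet f (\<phi> w)) P * (of_nat p * (jet f (\<phi> w) (Jet 1 2) * deriv \<phi> w) * ?J w ^ (p - Suc 0))) /
      (?J w ^ p * ?J w ^ p)) (at w)"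
      using J[OF w] by (intro DERIV_divide dP dJp) simp
    then have "(g has_field_derivative
      (eval_at (jet f (\<phi> w)) (D P) * deriv \<phi> w * ?J w ^ p -
       eval_at (jet f (\<phi> w)) P * (of_nat p * (jet f (\<phi> w) (Jet 1 2) * deriv \<phi> w) * ?J w ^ (p - Suc 0))) /
      (?J w ^ p * ?J w ^ p)) (at w)"
      by (rule has_field_derivative_transform_within_open[OF _ U w]) (simp add: g)
    then have "deriv g w =
      (eval_at (jet f (\<phi> w)) (D P) * deriv \<phi> w * ?J w ^ p -
       eval_at (jet f (\<phi> w)) P * (of_nat p * (jet f (\<phi> w) (Jet 1 2) * deriv \<phi> w) * ?J w ^ (p - Suc 0))) /
      (?J w ^ p * ?J w ^ p)"
      by (rule DERIV_imp_deriv)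
    also have "?J w ^ p = ?J w * ?J w ^ (p - Suc 0)" using p by (cases p) auto
    finally have deriv_g: "deriv g w =
      (eval_at (jet f (\<phi> w)) (D P) * deriv \<phi> w * (?J w * ?J w ^ (p - Suc 0)) -
       eval_at (jet f (\<phi> w)) P * (of_nat p * (jet f (\<phi> w) (Jet 1 2) * deriv \<phi> w) * ?J w ^ (p - Suc 0))) /
      (?J w * ?J w ^ (p - Suc 0) * (?J w * ?J w ^ (p - Suc 0)))" .
    \<comment> \<open>The cancellation in plain letters: a and e are the values of
      \<open>D P\<close> and \<open>P\<close>, b is f_1', c its power with exponent p - 1, d the
      derivative of \<phi>, r the number p, and s is f_1''.\<close>
    have "(a * d * (b * c) - e * (r * (s * d) * c)) / (b * c * (b * c)) =
        (a * b - r * e * s) / (b * (b * (b * c)))"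
      if "b \<noteq> 0" "c \<noteq> 0" "d = 1 / b" for a b c d e r s :: complex
      using that(1,2) unfolding that(3) by (simp add: field_simps)
    from this[OF J[OF w] power_not_zero[OF J[OF w]] dphi_eq[OF w]]
    have "(eval_at (jet f (\<phi> w)) (D P) * deriv \<phi> w * (?J w * ?J w ^ (p - Suc 0)) -
       eval_at (jet f (\<phi> w)) P * (of_nat p * (jet f (\<phi> w) (Jet 1 2) * deriv \<phi> w) * ?J w ^ (p - Suc 0))) /
      (?J w * ?J w ^ (p - Suc 0) * (?J w * ?J w ^ (p - Suc 0))) =
      eval_at (jet f (\<phi> w)) (bracket p 1 P (Var (Jet 1 1))) / (?J w * (?J w * (?J w * ?J w ^ (p - Suc 0))))"
      unfolding eval_at_bracket .
    with deriv_g have "deriv g w = eval_at (jet f (\<phi> w)) (bracket p 1 P (Var (Jet 1 1))) /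
      (?J w * (?J w * (?J w * ?J w ^ (p - Suc 0))))"
      by (rule trans)
    also have "?J w * (?J w * (?J w * ?J w ^ (p - Suc 0))) = ?J w ^ (p + 2)"
      using p by (cases p) auto
    finally show ?thesis .
  qed
  have "(deriv ^^ l) (f i \<circ> \<phi>) w = eval_at (jet f (\<phi> w)) (Lam i l) / ?J w ^ (2 * l - 1)"
    if "2 \<le> l" "w \<in> U" for w l
    using that
  proof (induction l arbitrary: w rule: nat_induct_at_least)
    case base
    have "(deriv ^^ 2) (f i \<circ> \<phi>) w = deriv (deriv (f i \<circ> \<phi>)) w" by (simp add: numeral_2_eq_2)
    also have "\<dots> = eval_at (jet f (\<phi> w)) (Lam i 2) / ?J w ^ (1 + 2)"
      unfolding Lam_2 by (rule step) (use d1 base in auto)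
    also have "1 + 2 = 2 * 2 - (1 :: nat)" by simp
    finally show ?case .
  next
    case (Suc l)
    have "(deriv ^^ Suc l) (f i \<circ> \<phi>) w = deriv ((deriv ^^ l) (f i \<circ> \<phi>)) w" by simp
    also have "\<dots> = eval_at (jet f (\<phi> w)) (Lam i (Suc l)) / ?J w ^ (2 * l - 1 + 2)"
      unfolding Lam_Suc[OF Suc.hyps] by (rule step[OF Suc.IH]) (use Suc in simp_all)
    also have "2 * l - 1 + 2 = 2 * Suc l - 1" using Suc.hyps by simp
    finally show ?case .
  qed
  then show "2 \<le> l \<Longrightarrow> (deriv ^^ l) (f i \<circ> \<phi>) w = eval_at (jet f (\<phi> w)) (Lam i l) / ?J w ^ (2 * l - 1)"
    using w by blast
qed

text \<open>Realises an arbitrary jet of order \<kappa> by an entire curve through the origin, so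
  that germ identities become identities at every point of jet space.\<close>

definition taylor_curve :: "nat \<Rightarrow> (jet_var \<Rightarrow> complex) \<Rightarrow> nat \<Rightarrow> complex \<Rightarrow> complex" where
  "taylor_curve \<kappa> x i = poly (\<Sum>l\<in>{1..\<kappa>}. monom (x (Jet i l) / fact l) l)"

lemma taylor_curve_holomorphic [simp]: "taylor_curve \<kappa> x i holomorphic_on S"
  unfolding taylor_curve_def by (intro holomorphic_intros)

lemma taylor_curve_0 [simp]: "taylor_curve \<kappa> x i 0 = 0"
  by (simp add: taylor_curve_def poly_0_coeff_0 coeff_sum)

lemma higher_deriv_poly:
  fixes p :: "complex poly"
  shows "(deriv ^^ k) (poly p) = poly ((pderiv ^^ k) p)"
proof (induction k)
  case (Suc k)
  have "deriv (poly q) = poly (pderiv q)" for q :: "complex poly"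
    by (rule ext) (rule DERIV_imp_deriv, rule poly_DERIV)
  then show ?case using Suc by simp
qed simp

lemma jet_taylor_curve:
  assumes "1 \<le> l" "l \<le> \<kappa>"
  shows "jet (taylor_curve \<kappa> x) 0 (Jet i l) = x (Jet i l)"
  using assms
  by (simp add: jet_def taylor_curve_def higher_deriv_poly poly_0_coeff_0 coeff_higher_pderiv coeff_sum
      flip: pochhammer_fact)

lemma eval_at_jet_taylor_curve:
  assumes "vars P \<subseteq> {Jet i l | i l. 1 \<le> l \<and> l \<le> \<kappa>}"
  shows "eval_at (jet (taylor_curve \<kappa> x) 0) P = eval_at x P"
  by (rule eval_at_cong) (use assms in \<open>auto simp: jet_taylor_curve\<close>)

section \<open>Consequences of the two invariances\<close>

lemma UE_vars: "BP \<in> UE n \<kappa> m \<Longrightarrow> vars BP \<subseteq> {Jet i l | i l. 1 \<le> i \<and> i \<le> n \<and> 1 \<le> l \<and> l \<le> \<kappa>}"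
  by (simp add: UE_def jet_polys_def jet_vars_def)

lemma UE_vars': "BP \<in> UE n \<kappa> m \<Longrightarrow> vars BP \<subseteq> {Jet i l | i l. 1 \<le> l \<and> l \<le> \<kappa>}"
  by (rule order.trans[OF UE_vars]) auto

lemma UE_reparam:
  assumes "BP \<in> UE n \<kappa> m" "\<And>i. f i holomorphic_on UNIV" "local_biholomorphism \<phi>"
  shows "eval_at (jet (\<lambda>i. f i \<circ> \<phi>) 0) BP = deriv \<phi> 0 ^ m * eval_at (jet f 0) BP"
proof -
  have "\<forall>i\<in>{1..n}. f i analytic_on {0}"
    using assms(2) analytic_on_holomorphic by blast
  then have "\<forall>\<^sub>F z in nhds 0. eval_at (jet (\<lambda>i. f i \<circ> \<phi>) z) BP = deriv \<phi> z ^ m * eval_at (jet f (\<phi> z)) BP"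
    using assms by (simp add: UE_def reparam_invariant_def)
  from eventually_nhds_x_imp_x[OF this] show ?thesis
    using assms(3) by (simp add: local_biholomorphism_def)
qed

text \<open>Reparametrising a curve with jet \<open>x\<close> by z \<mapsto> t z multiplies its
  derivatives of order l by t^l.\<close>

lemma UE_scale:
  assumes "BP \<in> UE n \<kappa> m" "t \<noteq> 0"
  shows "eval_at (\<lambda>v. t ^ jet_order v * x v) BP = t ^ m * eval_at x BP"
proof -
  let ?f = "taylor_curve \<kappa> x" and ?s = "\<lambda>z. t * z"
  have "local_biholomorphism ?s"
    unfolding local_biholomorphism_def
  proof (intro conjI exI[of _ UNIV] exI[of _ "\<lambda>z. z / t"])
    have "?s ` UNIV = UNIV" using assms(2) by (auto intro!: image_eqI[of _ _ "_ / t"])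
    then show "open (range ?s)" by simp
  qed (use assms(2) in \<open>auto intro!: holomorphic_intros\<close>)
  from UE_reparam[OF assms(1) _ this, of ?f]
  have "eval_at (jet (\<lambda>i. ?f i \<circ> ?s) 0) BP = deriv ?s 0 ^ m * eval_at (jet ?f 0) BP" by simp
  also have "deriv ?s 0 = t" by (rule DERIV_imp_deriv) (auto intro!: derivative_eq_intros)
  also have "eval_at (jet ?f 0) BP = eval_at x BP"
    using UE_vars'[OF assms(1)] by (rule eval_at_jet_taylor_curve)
  also have "eval_at (jet (\<lambda>i. ?f i \<circ> ?s) 0) BP = eval_at (\<lambda>v. t ^ jet_order v * x v) BP"
  proof (rule eval_at_cong)
    fix v assume "v \<in> vars BP"
    then obtain i l where v: "v = Jet i l" "1 \<le> l" "l \<le> \<kappa>" using UE_vars'[OF assms(1)] by auto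
    have "jet (\<lambda>i. ?f i \<circ> ?s) 0 v = t ^ l * jet ?f 0 v"
      using higher_deriv_compose_linear'[of "?f i" UNIV UNIV 0 t 0 l] by (simp add: v jet_def o_def)
    then show "jet (\<lambda>i. ?f i \<circ> ?s) 0 v = t ^ jet_order v * x v"
      using v by (simp add: jet_taylor_curve)
  qed
  finally show ?thesis .
qed

text \<open>Differentiating the scaling law at t = 1 gives the weighted Euler equation; comparing
  coefficients fixes the weight of each monomial.\<close>

lemma UE_homogeneous:
  assumes "BP \<in> UE n \<kappa> m" "\<mu> \<in> supp BP"
  shows "wdeg jet_order \<mu> = m"
proof -
  have "(\<Sum>v\<in>vars BP. Const (of_nat (jet_order v)) * (Var v * pdiff v BP)) = Const (of_nat m) * BP"
  proof (rule cpoly_eqI)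
    fix x
    have "((\<lambda>t. eval_at (\<lambda>v. t ^ jet_order v * x v) BP) has_field_derivative
      (\<Sum>v\<in>vars BP. of_nat (jet_order v) * x v * eval_at (\<lambda>v. 1 ^ jet_order v * x v) (pdiff v BP))) (at 1)"
      by (rule has_field_derivative_eval_at) (auto intro!: derivative_eq_intros)
    then have "((\<lambda>t. t ^ m * eval_at x BP) has_field_derivative
      (\<Sum>v\<in>vars BP. of_nat (jet_order v) * x v * eval_at (\<lambda>v. 1 ^ jet_order v * x v) (pdiff v BP))) (at 1)"
      \<comment> \<open>The scaling law requires t \<noteq> 0, which leaves an open neighbourhood of
        1.\<close>
      by (rule has_field_derivative_transform_within_open[of _ _ _ "- {0}"])
        (auto simp: UE_scale[OF assms(1)])
    moreover have "((\<lambda>t. t ^ m * eval_at x BP) has_field_derivative of_nat m * eval_at x BP) (at 1)"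
      by (auto intro!: derivative_eq_intros)
    ultimately have "(\<Sum>v\<in>vars BP. of_nat (jet_order v) * x v * eval_at x (pdiff v BP)) = of_nat m * eval_at x BP"
      using DERIV_unique[of "\<lambda>t. t ^ m * eval_at x BP" _ 1] by (simp add: mult.assoc)
    then show "eval_at x (\<Sum>v\<in>vars BP. Const (of_nat (jet_order v)) * (Var v * pdiff v BP)) =
      eval_at x (Const (of_nat m) * BP)"
      by (simp add: mult.assoc)
  qed
  then have "coef (\<Sum>v\<in>vars BP. Const (of_nat (jet_order v)) * (Var v * pdiff v BP)) \<mu> = of_nat m * coef BP \<mu>"
    by (simp add: coef_Const_mult)
  moreover have "coef (\<Sum>v\<in>vars BP. Const (of_nat (jet_order v)) * (Var v * pdiff v BP)) \<mu> =
    of_nat (\<Sum>v\<in>vars BP. coef \<mu> v * jet_order v) * coef BP \<mu>"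
    by (simp add: lookup_sum coef_Const_mult coef_Euler sum_distrib_right) (simp add: mult_ac)
  moreover have "(\<Sum>v\<in>vars BP. coef \<mu> v * jet_order v) = wdeg jet_order \<mu>"
    using assms(2) by (intro wdeg_superset[symmetric]) (auto simp: vars_def)
  moreover have "coef BP \<mu> \<noteq> 0" using assms(2) by (simp add: in_keys_iff)
  ultimately show ?thesis by (metis mult_right_cancel of_nat_eq_iff)
qed

text \<open>Stated pointwise, so that the matrix \<open>u\<close> may be chosen in terms of the
  point \<open>z\<close>.\<close>

lemma UE_unipotent:
  assumes "BP \<in> UE n \<kappa> m"
  shows "eval_at (\<lambda>v. z v + (\<Sum>j\<in>{1..<component v}. u (component v) j * z (Jet j (jet_order v)))) BP = eval_at z BP"
proof -
  have "eval_at z BP = eval_at z (subst (unipotent_action u) BP)"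
    using assms by (simp add: UE_def unipotent_invariant_def)
  then show ?thesis by (simp add: eval_at_subst unipotent_action_def)
qed

text \<open>The jets with f_1 = id and f_i' = 0. The variables left free are those that receive the
  quotients \<open>Lam i l\<close> / f_1'^(2l-1).\<close>

definition normal_form :: "jet_var \<Rightarrow> jet_var cpoly" where
  "normal_form v = (if component v = 1 then (if jet_order v = 1 then 1 else 0)
     else if jet_order v = 1 then 0 else Var v)"

text \<open>Reparametrising by the local inverse of \<open>f\<^sub>1\<close> turns \<open>f\<^sub>1\<close> into the identity; a unipotent
  matrix then removes the first derivatives of the other components.\<close>

lemma UE_normal_form:
  assumes BP: "BP \<in> UE n \<kappa> m" and \<kappa>: "1 \<le> \<kappa>" and x: "x (Jet 1 1) \<noteq> 0"
  shows "eval_at x BP = x (Jet 1 1) ^ m *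
    eval_at (\<lambda>v. eval_at x (Lam (component v) (jet_order v)) / x (Jet 1 1) ^ (2 * jet_order v - 1))
      (subst normal_form BP)"
proof -
  let ?f = "taylor_curve \<kappa> x"
  have J: "jet ?f 0 (Jet 1 1) = x (Jet 1 1)" using \<kappa> by (intro jet_taylor_curve) auto
  then have "deriv (?f 1) 0 \<noteq> 0" using x by (simp add: jet_def)
  \<comment> \<open>The inverse function theorem at 0 supplies a ball on which f_1 is injective with
    open image; \<phi> is the inverse on that image.\<close>
  with has_complex_derivative_locally_invertible[of "?f 1" UNIV 0]
  obtain r where r: "r > 0" "open (?f 1 ` ball 0 r)" "inj_on (?f 1) (ball 0 r)" by auto
  from holomorphic_has_inverse[OF taylor_curve_holomorphic open_ball r(3)]
  obtain \<phi> where phi: "\<phi> holomorphic_on ?f 1 ` ball 0 r"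
    "\<And>z. z \<in> ball 0 r \<Longrightarrow> \<phi> (?f 1 z) = z" by metis
  let ?U = "?f 1 ` ball 0 r"
  have inv: "?f 1 (\<phi> w) = w" if "w \<in> ?U" for w using that phi(2) by auto
  have "0 \<in> ?U" using r(1) by (auto intro!: image_eqI[of _ _ 0])
  have phi_0: "\<phi> 0 = 0" using phi(2)[of 0] r(1) by simp
  have "\<phi> ` ?U = ball 0 r" using phi(2) by (simp add: image_image)
  then have open_image: "open (\<phi> ` ?U)" by simp
  have "local_biholomorphism \<phi>"
    unfolding local_biholomorphism_def
    using r(2) \<open>0 \<in> ?U\<close> phi_0 phi(1) inv open_image taylor_curve_holomorphic
    by (intro conjI exI[of _ ?U] exI[of _ "?f 1"]) blast+
  define z where "z = jet (\<lambda>i. ?f i \<circ> \<phi>) 0"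
  note inverse_jets = higher_deriv_comp_inverse[of ?f ?U \<phi> 0,
      OF taylor_curve_holomorphic r(2) phi(1) inv \<open>0 \<in> ?U\<close>, unfolded phi_0 J]
  have "eval_at z BP = deriv \<phi> 0 ^ m * eval_at (jet ?f 0) BP"
    unfolding z_def using BP _ \<open>local_biholomorphism \<phi>\<close> by (rule UE_reparam) simp
  also have "eval_at (jet ?f 0) BP = eval_at x BP"
    using UE_vars'[OF BP] by (rule eval_at_jet_taylor_curve)
  also have "deriv \<phi> 0 = 1 / x (Jet 1 1)" by (rule inverse_jets)
  finally have "eval_at x BP = x (Jet 1 1) ^ m * eval_at z BP"
    using x by (simp add: field_simps)
  \<comment> \<open>The first column of the matrix consists of minus the first derivatives of the
    reparametrised curve; its other entries below the diagonal are 0. Since the first component is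
    now the identity, this removes the first derivatives and leaves the higher ones alone.\<close>
  also have "eval_at z BP = eval_at (\<lambda>v. z v + (\<Sum>j\<in>{1..<component v}.
    (if j = 1 then - z (Jet (component v) 1) else 0) * z (Jet j (jet_order v)))) BP"
    by (rule UE_unipotent[OF BP, symmetric])
  also have "\<dots> = eval_at (\<lambda>v. eval_at (\<lambda>v. eval_at x (Lam (component v) (jet_order v)) /
    x (Jet 1 1) ^ (2 * jet_order v - 1)) (normal_form v)) BP"
  proof (rule eval_at_cong)
    fix v assume "v \<in> vars BP"
    then obtain i l where v: "v = Jet i l" "1 \<le> i" "1 \<le> l" "l \<le> \<kappa>" using UE_vars[OF BP] by blast
    have z_1: "z (Jet 1 k) = (if k = 1 then 1 else 0)" if "k \<ge> 1" for k
    proof -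
      have "?f 1 \<circ> \<phi> holomorphic_on ?U"
        using phi(1) taylor_curve_holomorphic by (rule holomorphic_on_compose)
      then have "z (Jet 1 k) = (deriv ^^ k) (\<lambda>w. w) 0"
        unfolding z_def jet_def jet_var.sel using r(2) \<open>0 \<in> ?U\<close> inv
        by (intro higher_deriv_transform_within_open[of _ ?U]) (auto intro: holomorphic_on_ident)
      then show ?thesis using that by simp
    qed
    have z_Lam: "z (Jet i k) = eval_at x (Lam i k) / x (Jet 1 1) ^ (2 * k - 1)" if "2 \<le> k" "k \<le> \<kappa>" for k
    proof -
      have "vars (Lam i k) \<subseteq> {Jet i l | i l. 1 \<le> l \<and> l \<le> \<kappa>}"
        by (rule order.trans[OF vars_Lam[OF that(1)]]) (use that(2) in auto)
      then have "eval_at (jet ?f 0) (Lam i k) = eval_at x (Lam i k)" by (rule eval_at_jet_taylor_curve)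
      then show ?thesis using inverse_jets(4)[OF _ that(1), of i] by (simp add: z_def jet_def)
    qed
    have "z (Jet i l) + (\<Sum>j\<in>{1..<i}. (if j = 1 then - z (Jet i 1) else 0) * z (Jet j l)) =
      eval_at (\<lambda>v. eval_at x (Lam (component v) (jet_order v)) / x (Jet 1 1) ^ (2 * jet_order v - 1))
        (normal_form (Jet i l))"
    proof (cases "i = 1")
      case True
      then show ?thesis using z_1[OF v(3)] by (simp add: normal_form_def)
    next
      case False
      then have "(\<Sum>j\<in>{1..<i}. (if j = 1 then - z (Jet i 1) else 0) * z (Jet j l)) = - z (Jet i 1) * z (Jet 1 l)"
        using v(2) by (subst sum.remove[of _ 1]) auto
      then show ?thesis
        using False z_1[OF v(3)] z_Lam[of l] v(3,4) by (auto simp: normal_form_def)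
    qed
    then show "z v + (\<Sum>j\<in>{1..<component v}. (if j = 1 then - z (Jet (component v) 1) else 0) * z (Jet j (jet_order v))) =
      eval_at (\<lambda>v. eval_at x (Lam (component v) (jet_order v)) / x (Jet 1 1) ^ (2 * jet_order v - 1)) (normal_form v)"
      by (simp only: v(1) jet_var.sel)
  qed
  also have "\<dots> = eval_at (\<lambda>v. eval_at x (Lam (component v) (jet_order v)) / x (Jet 1 1) ^ (2 * jet_order v - 1))
    (subst normal_form BP)"
    by (simp add: eval_at_subst)
  finally show ?thesis .
qed

text \<open>Component 1 and order 1 are normalised away: row \<open>i\<close> is component
  \<open>i + 2\<close>, and columns start at 2.\<close>

lemma var_matrix_Jet: "var_matrix (\<lambda>i. Jet (Suc (Suc i))) {2..\<kappa>}"
  by unfold_locales auto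

text \<open>Adding t times component p + 2 to component i + 2 respects the normal form, because f_1
  is untouched and the first derivatives involved are 0. The polynomial is therefore constant in t,
  and its derivative at t = 0 is the polarisation.\<close>

lemma normal_form_polar:
  assumes BP: "BP \<in> UE n \<kappa> m" and "p < i"
  shows "var_matrix.polar (\<lambda>i. Jet (Suc (Suc i))) {2..\<kappa>} p i (subst normal_form BP) = 0"
proof (rule cpoly_eqI)
  interpret var_matrix "\<lambda>i. Jet (Suc (Suc i))" "{2..\<kappa>}" by (rule var_matrix_Jet)
  fix w :: "jet_var \<Rightarrow> complex"
  let ?Q = "subst normal_form BP"
  let ?V = "Jet (Suc (Suc i)) ` {2..\<kappa>}"
  \<comment> \<open>\<open>\<gamma>\<close> changes free variables only; \<open>pad\<close>
    completes a choice of free variables to a full normalised jet.\<close>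
  define \<gamma> where "\<gamma> t v = w v + (if v \<in> ?V then t * w (Jet (Suc (Suc p)) (jet_order v)) else 0)" for t v
  define pad where "pad = (\<lambda>(w :: jet_var \<Rightarrow> complex) v. eval_at w (normal_form v))"
  have "eval_at (\<gamma> t) ?Q = eval_at w ?Q" for t
  proof -
    have "eval_at w ?Q = eval_at (pad w) BP" by (simp add: eval_at_subst pad_def)
    \<comment> \<open>The elementary matrix with the single off-diagonal entry t at position (i + 2,
      p + 2).\<close>
    also have "\<dots> = eval_at (\<lambda>v. pad w v + (\<Sum>j\<in>{1..<component v}.
      (if component v = Suc (Suc i) \<and> j = Suc (Suc p) then t else 0) * pad w (Jet j (jet_order v)))) BP"
      by (rule UE_unipotent[OF BP, symmetric])
    also have "\<dots> = eval_at (pad (\<gamma> t)) BP"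
    proof (rule eval_at_cong)
      fix v assume "v \<in> vars BP"
      then obtain a l where v: "v = Jet a l" "1 \<le> l" "l \<le> \<kappa>" using UE_vars[OF BP] by blast
      show "pad w v + (\<Sum>j\<in>{1..<component v}.
        (if component v = Suc (Suc i) \<and> j = Suc (Suc p) then t else 0) * pad w (Jet j (jet_order v))) = pad (\<gamma> t) v"
      proof (cases "a = Suc (Suc i)")
        case True
        then have "(\<Sum>j\<in>{1..<a}. (if a = Suc (Suc i) \<and> j = Suc (Suc p) then t else 0) * pad w (Jet j l)) =
          t * pad w (Jet (Suc (Suc p)) l)"
          using \<open>p < i\<close> by (subst sum.remove[of _ "Suc (Suc p)"]) (auto intro!: sum.neutral)
        then show ?thesis
          using True v by (auto simp: pad_def normal_form_def \<gamma>_def)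
      next
        case False
        then show ?thesis by (auto simp: v pad_def normal_form_def \<gamma>_def)
      qed
    qed
    also have "\<dots> = eval_at (\<gamma> t) ?Q" by (simp add: eval_at_subst pad_def)
    finally show ?thesis by simp
  qed
  moreover have "((\<lambda>t. eval_at (\<gamma> t) ?Q) has_field_derivative
    (\<Sum>v\<in>vars ?Q \<union> ?V. (if v \<in> ?V then w (Jet (Suc (Suc p)) (jet_order v)) else 0) * eval_at (\<gamma> 0) (pdiff v ?Q))) (at 0)"
    by (rule has_field_derivative_eval_at) (auto simp: \<gamma>_def intro!: derivative_eq_intros)
  ultimately have "((\<lambda>t. eval_at w ?Q) has_field_derivative
    (\<Sum>v\<in>vars ?Q \<union> ?V. (if v \<in> ?V then w (Jet (Suc (Suc p)) (jet_order v)) else 0) * eval_at (\<gamma> 0) (pdiff v ?Q))) (at 0)"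
    by simp
  then have "(\<Sum>v\<in>vars ?Q \<union> ?V. (if v \<in> ?V then w (Jet (Suc (Suc p)) (jet_order v)) else 0) * eval_at (\<gamma> 0) (pdiff v ?Q)) = 0"
    using DERIV_const DERIV_unique by blast
  also have "(\<Sum>v\<in>vars ?Q \<union> ?V. (if v \<in> ?V then w (Jet (Suc (Suc p)) (jet_order v)) else 0) * eval_at (\<gamma> 0) (pdiff v ?Q)) =
    (\<Sum>v\<in>?V. w (Jet (Suc (Suc p)) (jet_order v)) * eval_at w (pdiff v ?Q))"
  proof (rule sum.mono_neutral_cong_right)
    have "\<gamma> 0 = w" by (auto simp: \<gamma>_def)
    then show "(if v \<in> ?V then w (Jet (Suc (Suc p)) (jet_order v)) else 0) * eval_at (\<gamma> 0) (pdiff v ?Q) =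
      w (Jet (Suc (Suc p)) (jet_order v)) * eval_at w (pdiff v ?Q)" if "v \<in> ?V" for v
      using that by simp
  qed auto
  also have "\<dots> = eval_at w (polar p i ?Q)"
    by (subst sum.reindex) (auto simp: inj_on_def polar_def)
  finally show "eval_at w (polar p i ?Q) = eval_at w 0" by simp
qed

text \<open>The bound m survives the loss of homogeneity, since replacing variables by 1 or 0 never
  raises a weight.\<close>

lemma normal_form_minor_poly:
  assumes BP: "BP \<in> UE n \<kappa> m"
  shows "var_matrix.minor_poly (\<lambda>i. Jet (Suc (Suc i))) {2..\<kappa>} (n - 1) m (subst normal_form BP)"
proof -
  interpret var_matrix "\<lambda>i. Jet (Suc (Suc i))" "{2..\<kappa>}" by (rule var_matrix_Jet)
  show ?thesis
  proof (rule unipotent_first_fundamental[where w = jet_order])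
    show "vars (subst normal_form BP) \<subseteq> {Jet (Suc (Suc i)) l | i l. i < n - 1 \<and> l \<in> {2..\<kappa>}}"
    proof (rule order.trans[OF vars_subst UN_least])
      fix v assume "v \<in> vars BP"
      then obtain i l where v: "v = Jet i l" "1 \<le> i" "i \<le> n" "1 \<le> l" "l \<le> \<kappa>" using UE_vars[OF BP] by blast
      show "vars (normal_form v) \<subseteq> {Jet (Suc (Suc i)) l | i l. i < n - 1 \<and> l \<in> {2..\<kappa>}}"
      proof (cases "i = 1 \<or> l = 1")
        case True
        then have "normal_form v = 1 \<or> normal_form v = 0" by (auto simp: v normal_form_def)
        then show ?thesis by auto
      next
        case False
        then have "Jet i l = Jet (Suc (Suc (i - 2))) l" "i - 2 < n - 1" "l \<in> {2..\<kappa>}" using v by auto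
        then have "Jet i l \<in> {Jet (Suc (Suc i)) l | i l. i < n - 1 \<and> l \<in> {2..\<kappa>}}" by blast
        moreover have "vars (normal_form v) = {Jet i l}" using False by (simp add: v normal_form_def)
        ultimately show ?thesis by simp
      qed
    qed
    show "wdeg_le jet_order m (subst normal_form BP)"
    proof (rule wdeg_le_subst)
      show "wdeg_le jet_order (jet_order v) (normal_form v)" for v
        by (auto simp: normal_form_def intro: wdeg_le_Var)
      show "wdeg_le jet_order m BP"
        using UE_homogeneous[OF BP] by (auto simp: wdeg_le_def)
    qed
    show "polar p i (subst normal_form BP) = 0" if "p < i" for p i
      by (rule normal_form_polar[OF BP that])
  qed auto
qed

section \<open>From minors of the quotients to the displayed determinants\<close>

lemma Lam_minor_expand:
  "Lam_minor (n, ls) = (\<Sum>s | s permutes {0..<n - 1}.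
     of_int (sign s) * (\<Prod>i\<in>{0..<n - 1}. Lam (s i + 2) (ls (i + 2))))"
proof -
  \<comment> \<open>The matrix has jet orders as rows and components as columns, so the Leibniz
    formula permutes components, exactly as \<open>minor\<close> does.\<close>
  have "Lam_minor (n, ls) = (\<Sum>s | s permutes {0..<n - 1}. of_int (sign s) *
    (\<Prod>i\<in>{0..<n - 1}. Matrix.mat (n - 1) (n - 1) (\<lambda>(r, c). Lam (c + 2) (ls (r + 2))) $$ (i, s i)))"
    by (simp add: Lam_minor_def det_def)
  also have "\<dots> = (\<Sum>s | s permutes {0..<n - 1}.
     of_int (sign s) * (\<Prod>i\<in>{0..<n - 1}. Lam (s i + 2) (ls (i + 2))))"
  proof (intro sum.cong refl arg_cong2[where f = "(*)"] prod.cong)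
    fix s i assume "s \<in> {s. s permutes {0..<n - 1}}" "i \<in> {0..<n - 1}"
    then show "Matrix.mat (n - 1) (n - 1) (\<lambda>(r, c). Lam (c + 2) (ls (r + 2))) $$ (i, s i) = Lam (s i + 2) (ls (i + 2))"
      using permutes_in_image[of s "{0..<n - 1}" i] by auto
  qed
  finally show ?thesis .
qed

definition pole_order :: "minor_index \<Rightarrow> nat" where
  "pole_order = (\<lambda>(n, ls). \<Sum>j\<in>{2..n}. 2 * ls j - 1)"

text \<open>Each Leibniz term contains one quotient of order \<open>ls j\<close> for every
  \<open>j\<close>, so all terms have the same denominator.\<close>

lemma eval_at_indexed_minor:
  "eval_at (\<lambda>v. eval_at x (Lam (component v) (jet_order v)) / y ^ (2 * jet_order v - 1))
     (var_matrix.indexed_minor (\<lambda>i. Jet (Suc (Suc i))) idx) =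
   eval_at x (Lam_minor idx) / y ^ pole_order idx"
proof (cases idx)
  case (Pair n ls)
  interpret var_matrix "\<lambda>i. Jet (Suc (Suc i))" "{2..\<kappa>}" for \<kappa> by (rule var_matrix_Jet)
  have "(\<Sum>j\<in>{2..n}. 2 * ls j - 1) = (\<Sum>i\<in>{0..<n - 1}. 2 * ls (i + 2) - 1)"
  proof (rule sum.reindex_bij_witness[of _ "\<lambda>i. i + 2" "\<lambda>j. j - 2"])
    show "2 * ls (j - 2 + 2) - 1 = 2 * ls j - 1" if "j \<in> {2..n}" for j
      using that by (simp only: le_add_diff_inverse2 atLeastAtMost_iff)
  qed auto
  then show ?thesis
    by (simp add: Pair indexed_minor_def minor_def Lam_minor_expand pole_order_def prod_dividef
        sum_divide_distrib power_sum)
qed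

lemma mono_value_divide_power:
  "mono_value (\<lambda>v. a v / (y :: complex) ^ e v) \<mu> = mono_value a \<mu> / y ^ wdeg e \<mu>"
  by (simp add: mono_value_def wdeg_def power_divide prod_dividef power_sum mult.commute
      flip: power_mult)

lemma eval_at_mono_value: "eval_at x (mono_value s \<mu>) = mono_value (\<lambda>v. eval_at x (s v)) \<mu>"
  by (simp add: mono_value_def)

lemma to_fract_power: "to_fract (P ^ k) = to_fract P ^ k"
  by (induction k) simp_all

theorem mainTheorem8:
  fixes n \<kappa> m :: nat and BP :: "jet_var cpoly"
  assumes "n \<ge> 1" and "\<kappa> \<ge> 1"
    and "BP \<in> UE n \<kappa> m"
  shows "\<exists>BPs :: int \<Rightarrow> minor_index cpoly.
    (\<forall>a. vars (BPs a) \<subseteq> minor_indices n \<kappa>) \<and>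
    to_fract BP =
      (\<Sum>a\<in>{a::int. - ((real \<kappa> - 1) / real \<kappa>) * real m \<le> real_of_int a \<and> real_of_int a \<le> real m}.
         to_fract (Var (Jet 1 1)) powi a * to_fract (subst Lam_minor (BPs a)))"
proof -
  interpret var_matrix "\<lambda>i. Jet (Suc (Suc i))" "{2..\<kappa>}" by (rule var_matrix_Jet)
  let ?v = "Var (Jet 1 1) :: jet_var cpoly"
  obtain T where T_vars: "vars T \<subseteq> indices (n - 1)" and T_wdeg: "wdeg_le index_weight m T"
    and T: "subst normal_form BP = subst indexed_minor T"
    using normal_form_minor_poly[OF assms(3)] unfolding minor_poly_def by blast
  have indices_eq: "indices (n - 1) = minor_indices n \<kappa>"
    using assms(1) by (simp add: indices_def minor_indices_def)
  \<comment> \<open>The inequality for a single order l is l \<le> \<kappa> rearranged; it is then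
    summed over the columns of each minor and the minors of a monomial.\<close>
  have pole_le: "\<kappa> * wdeg pole_order \<mu> \<le> (2 * \<kappa> - 1) * m" if "\<mu> \<in> supp T" for \<mu>
  proof -
    have "\<kappa> * pole_order idx \<le> (2 * \<kappa> - 1) * index_weight idx" if "idx \<in> minor_indices n \<kappa>" for idx
    proof -
      obtain n1 ls where idx: "idx = (n1, ls)" by (cases idx)
      then have ls: "2 \<le> ls j \<and> ls j \<le> \<kappa>" if "j \<in> {2..n1}" for j
        using \<open>idx \<in> minor_indices n \<kappa>\<close> that by (auto simp: minor_indices_def dest!: PiE_mem)
      have "\<kappa> * (2 * l - 1) \<le> (2 * \<kappa> - 1) * l" if "l \<le> \<kappa>" for l
        using that by (simp add: diff_mult_distrib diff_mult_distrib2)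
      then show ?thesis using ls unfolding idx pole_order_def index_weight_def
        by (auto simp: sum_distrib_left intro!: sum_mono)
    qed
    moreover have "supp \<mu> \<subseteq> minor_indices n \<kappa>"
      using T_vars that unfolding indices_eq vars_def by blast
    ultimately have "\<kappa> * wdeg pole_order \<mu> \<le> (2 * \<kappa> - 1) * wdeg index_weight \<mu>"
      unfolding wdeg_def sum_distrib_left
      by (intro sum_mono) (metis mult.left_commute mult_le_mono2 subsetD)
    also have "\<dots> \<le> (2 * \<kappa> - 1) * m" using T_wdeg that by (simp add: wdeg_le_def)
    finally show ?thesis .
  qed
  \<comment> \<open>Makes 2m minus the pole order a natural exponent, so that multiplication by
    f_1'^m turns the formula into an identity of polynomials.\<close>
  have pole_le': "wdeg pole_order \<mu> \<le> 2 * m" if "\<mu> \<in> supp T" for \<mu>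
  proof -
    have "\<kappa> * wdeg pole_order \<mu> \<le> \<kappa> * (2 * m)"
      using pole_le[OF that] by (rule order.trans) (simp add: diff_mult_distrib)
    then show ?thesis using assms(2) by simp
  qed
  have "BP * ?v ^ m = (\<Sum>\<mu>\<in>supp T. Const (coef T \<mu>) * (?v ^ (2 * m - wdeg pole_order \<mu>) * mono_value Lam_minor \<mu>))"
    (is "_ = ?R")
  proof -
    \<comment> \<open>The normal form is available only where f_1' is non-zero. The extra factor
      makes both sides vanish elsewhere and is cancelled afterwards in the integral domain.\<close>
    have "?v * (BP * ?v ^ m) = ?v * ?R"
    proof (rule cpoly_eqI)
      fix x :: "jet_var \<Rightarrow> complex"
      let ?y = "x (Jet 1 1)"
      show "eval_at x (?v * (BP * ?v ^ m)) = eval_at x (?v * ?R)"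
      proof (cases "?y = 0")
        case False
        have "eval_at x BP = ?y ^ m * (\<Sum>\<mu>\<in>supp T. coef T \<mu> *
          (mono_value (\<lambda>idx. eval_at x (Lam_minor idx)) \<mu> / ?y ^ wdeg pole_order \<mu>))"
          unfolding UE_normal_form[where x = x, OF assms(3,2) False] T eval_at_subst eval_at_indexed_minor
            eval_at_eq_sum[of _ T] mono_value_divide_power ..
        then have "eval_at x BP * ?y ^ m = (\<Sum>\<mu>\<in>supp T. coef T \<mu> *
          (?y ^ m * ?y ^ m / ?y ^ wdeg pole_order \<mu> * mono_value (\<lambda>idx. eval_at x (Lam_minor idx)) \<mu>))"
          by (simp add: sum_distrib_left mult_ac)
        also have "\<dots> = (\<Sum>\<mu>\<in>supp T. coef T \<mu> *
          (?y ^ (2 * m - wdeg pole_order \<mu>) * mono_value (\<lambda>idx. eval_at x (Lam_minor idx)) \<mu>))"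
          using False pole_le' by (intro sum.cong refl) (simp add: power_diff mult_2 power_add)
        finally show ?thesis by (simp add: eval_at_mono_value)
      qed simp
    qed
    then show ?thesis by (simp only: mult_cancel_left Var_neq_0 simp_thms)
  qed
  then have "to_fract BP * to_fract ?v ^ m = (\<Sum>\<mu>\<in>supp T.
    to_fract ?v ^ (2 * m - wdeg pole_order \<mu>) * to_fract (Const (coef T \<mu>) * mono_value Lam_minor \<mu>))"
    by (simp add: mult_ac flip: to_fract_power to_fract_mult to_fract_sum)
  moreover have v0: "to_fract ?v \<noteq> 0" by simp
  \<comment> \<open>The exponent m of the prefactor minus the pole order; it can be negative, which
    is why the identity lives in the fraction field.\<close>
  define a where "a \<mu> = int m - int (wdeg pole_order \<mu>)" for \<mu>
  have powi_a: "to_fract ?v ^ (2 * m - wdeg pole_order \<mu>) / to_fract ?v ^ m = to_fract ?v powi a \<mu>"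
    if "\<mu> \<in> supp T" for \<mu>
  proof -
    have "a \<mu> = int (2 * m - wdeg pole_order \<mu>) - int m" using pole_le'[OF that] by (simp add: a_def)
    then show ?thesis using v0 by (simp only: power_int_diff power_int_of_nat simp_thms)
  qed
  ultimately have "to_fract BP = (\<Sum>\<mu>\<in>supp T.
    to_fract ?v ^ (2 * m - wdeg pole_order \<mu>) * to_fract (Const (coef T \<mu>) * mono_value Lam_minor \<mu>)) / to_fract ?v ^ m"
    by (simp add: eq_divide_eq)
  also have "\<dots> = (\<Sum>\<mu>\<in>supp T. to_fract ?v powi a \<mu> * to_fract (Const (coef T \<mu>) * mono_value Lam_minor \<mu>))"
    unfolding sum_divide_distrib by (intro sum.cong refl) (simp only: powi_a[symmetric] times_divide_eq_left)
  finally have BP_eq: "to_fract BP =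
    (\<Sum>\<mu>\<in>supp T. to_fract ?v powi a \<mu> * to_fract (Const (coef T \<mu>) * mono_value Lam_minor \<mu>))" .
  \<comment> \<open>Monomials of \<open>T\<close> with the same pole order share a power of f_1' and
    are gathered into one polynomial.\<close>
  define BPs where "BPs b = restrict_supp (\<lambda>\<mu>. a \<mu> = b) T" for b
  define A where "A = {a::int. - ((real \<kappa> - 1) / real \<kappa>) * real m \<le> real_of_int a \<and> real_of_int a \<le> real m}"
  have "a ` supp T \<subseteq> A"
  proof
    fix b assume "b \<in> a ` supp T"
    then obtain \<mu> where \<mu>: "\<mu> \<in> supp T" "b = a \<mu>" by blast
    have "real (\<kappa> * wdeg pole_order \<mu>) \<le> real ((2 * \<kappa> - 1) * m)"
      using pole_le[OF \<mu>(1)] by (simp only: of_nat_le_iff)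
    then have "real \<kappa> * real (wdeg pole_order \<mu>) \<le> (2 * real \<kappa> - 1) * real m"
      using assms(2) by (simp add: of_nat_diff)
    then have "- ((real \<kappa> - 1) / real \<kappa>) * real m \<le> real m - real (wdeg pole_order \<mu>)"
      using assms(2) by (simp add: field_simps)
    then show "b \<in> A" by (simp add: A_def \<mu>(2) a_def)
  qed
  \<comment> \<open>A sum over an infinite index set would be 0 by convention, so the range of
    exponents has to be shown finite.\<close>
  moreover have "finite A"
  proof (rule finite_subset)
    have "(real \<kappa> - 1) / real \<kappa> * real m \<le> 1 * real m"
      by (intro mult_right_mono) (auto simp: divide_le_eq)
    then show "A \<subseteq> {- int m..int m}" by (auto simp: A_def)
  qed simp
  ultimately have "to_fract BP = (\<Sum>b\<in>A. \<Sum>\<mu>\<in>{\<mu> \<in> supp T. a \<mu> = b}.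
      to_fract ?v powi a \<mu> * to_fract (Const (coef T \<mu>) * mono_value Lam_minor \<mu>))"
    unfolding BP_eq by (intro sum.group[symmetric]) auto
  also have "\<dots> = (\<Sum>b\<in>A. to_fract ?v powi b * to_fract (subst Lam_minor (BPs b)))"
    unfolding subst_eq_sum BPs_def supp_restrict_supp coef_restrict_supp to_fract_sum sum_distrib_left
    by (intro sum.cong refl) auto
  finally have "to_fract BP = (\<Sum>b\<in>A. to_fract ?v powi b * to_fract (subst Lam_minor (BPs b)))" .
  moreover have "vars (BPs b) \<subseteq> minor_indices n \<kappa>" for b
    using T_vars unfolding indices_eq by (auto simp: vars_def BPs_def supp_restrict_supp)
  ultimately show ?thesis unfolding A_def by blast
qed

end
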